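(* For any choice of $\boldsymbol{w}$, the complement of the graph $G^{\boldsymbol{w}}$ is isomorphic to the graph $\Gamma_1$.
   Context: The $E_8$ root system $\Psi_{E_8}\subset\mathbb{R}^8$ consists of the 240 vectors $\pm e_i\pm e_j$ ($1\le i<j\le 8$) and all $x\in\{\pm1\}^8$ with $\prod_i x_i=1$. $G_{E_8}$ is the graph with vertices $v_x$, $x\in\Psi_{E_8}$, where $v_x=v_{-x}$, and $v_x\sim v_y$ iff $\langle x,y\rangle=0$. Let $I=\mathrm{diag}(1,1)$, $X=\begin{pmatrix}0&1\\1&0\end{pmatrix}$, $Z=\mathrm{diag}(1,-1)$, $Y=XZ$. For $M=M_1\otimes M_2\otimes M_3$ with $M_i\in\{I,X,Y,Z\}$, $\sigma_M:v_x\mapsto v_{Mx}$ is an automorphism of $G_{E_8}$ and $L=\{\sigma_M\}\cong\mathbb{Z}_2^6$. Let $V_1,\dots,V_{15}$ be the 15 orbits of $L$ on $V(G_{E_8})$. Given vectors $\boldsymbol{w}=\{w_1,\dots,w_{15}\}\subset\Psi_{E_8}$ with $v_{w_i}\in V_i$, the graph $G^{\boldsymbol{w}}$ has vertex set $V(G_{E_8})$; for $s\in V_i$, $t\in V_j$: if $\langle w_i,w_j\rangle\neq0$ then $s\sim t$ in $G^{\boldsymbol{w}}$ iff $s\sim t$ in $G_{E_8}$; if $\langle w_i,w_j\rangle=0$ then $s\sim t$ in $G^{\boldsymbol{w}}$ iff $s\not\sim t$ in $G_{E_8}$. The folded halved 8-cube graph has as vertices the pairs $\{x,\mathbf{1}+x\}$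 for $x\in\mathbb{F}_2^8$ with $\sum_ix_i=0$ ($\mathbf{1}$ the all-ones vector), two vertices $\{x,\mathbf{1}+x\},\{y,\mathbf{1}+y\}$ being adjacent iff $x+y$ or $x+y+\mathbf{1}$ has exactly two nonzero coordinates. The graph $\Gamma_1$ (Brouwer–Ivanov–Klin) has as vertices one orbit of the independent sets of size 8 of the folded halved 8-cube graph under the group $\mathbb{Z}_2^6\times A_8$ (generated by translations by even-weight vectors and even permutations of the 8 coordinates), namely the orbit of size 120 considered by Brouwer, Ivanov and Klin, giving a strongly regular graph with parameters $(120,56,28,24)$; two vertices are adjacent iff the corresponding independent sets have exactly two points in common. *)

theory Defs
  imports Main "HOL-Combinatorics.Permutations"
begin

text \<open>Vectors of R^8 with integer coordinates, represented as functions
  nat => int supported on {0..<8} (coordinate i+1 of the paper is index i).\<close>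

type_synonym vec8 = "nat \<Rightarrow> int"

definition inner8 :: "vec8 \<Rightarrow> vec8 \<Rightarrow> int" where
  "inner8 x y = (\<Sum>k<8. x k * y k)"

definition E8_roots :: "vec8 set" where
  "E8_roots =
     {x. \<exists>i j s t. i < j \<and> j < 8 \<and> s \<in> {1, -1} \<and> t \<in> {1, -1} \<and>
          x = (\<lambda>k. if k = i then s else if k = j then t else 0)}
   \<union> {x. (\<forall>k<8. x k \<in> {1, -1}) \<and> (\<forall>k\<ge>8. x k = 0) \<and> (\<Prod>k<8. x k) = 1}"

definition E8_verts :: "vec8 set set" where
  "E8_verts = {{x, - x} | x. x \<in> E8_roots}"

definition E8_adj :: "vec8 set \<Rightarrow> vec8 set \<Rightarrow> bool" where
  "E8_adj s t \<longleftrightarrow> (\<exists>x\<in>s. \<exists>y\<in>t. inner8 x y = 0)"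

datatype pauli = PI | PX | PY | PZ

text \<open>Entries of I, X, Z and Y = XZ, indices 0,1.\<close>

fun pauli_entry :: "pauli \<Rightarrow> nat \<Rightarrow> nat \<Rightarrow> int" where
  "pauli_entry PI i j = (if i = j then 1 else 0)"
| "pauli_entry PX i j = (if i \<noteq> j then 1 else 0)"
| "pauli_entry PZ i j = (if i = j then (if i = 0 then 1 else -1) else 0)"
| "pauli_entry PY i j = (if i = 0 \<and> j = 1 then -1 else if i = 1 \<and> j = 0 then 1 else 0)"

text \<open>Kronecker product M1 (x) M2 (x) M3, index i < 8 written in binary as (i div 4, i div 2 mod 2, i mod 2).\<close>

definition kron3_entry :: "pauli \<times> pauli \<times> pauli \<Rightarrow> nat \<Rightarrow> nat \<Rightarrow> int" where
  "kron3_entry M i j =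
     (case M of (M1, M2, M3) \<Rightarrow>
        pauli_entry M1 (i div 4) (j div 4) * pauli_entry M2 (i div 2 mod 2) (j div 2 mod 2)
        * pauli_entry M3 (i mod 2) (j mod 2))"

definition kron3_apply :: "pauli \<times> pauli \<times> pauli \<Rightarrow> vec8 \<Rightarrow> vec8" where
  "kron3_apply M x = (\<lambda>i. if i < 8 then (\<Sum>j<8. kron3_entry M i j * x j) else 0)"

definition sigma :: "pauli \<times> pauli \<times> pauli \<Rightarrow> vec8 set \<Rightarrow> vec8 set" where
  "sigma M v = kron3_apply M ` v"

definition L_orbit :: "vec8 set \<Rightarrow> vec8 set set" where
  "L_orbit s = {sigma M s | M. True}"

definition L_orbits :: "vec8 set set set" where
  "L_orbits = L_orbit ` E8_verts"

definition admissible_w :: "(vec8 set set \<Rightarrow> vec8) \<Rightarrow> bool" where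
  "admissible_w w \<longleftrightarrow> (\<forall>Vi\<in>L_orbits. w Vi \<in> E8_roots \<and> {w Vi, - w Vi} \<in> Vi)"

definition Gw_adj :: "(vec8 set set \<Rightarrow> vec8) \<Rightarrow> vec8 set \<Rightarrow> vec8 set \<Rightarrow> bool" where
  "Gw_adj w s t =
     (if inner8 (w (L_orbit s)) (w (L_orbit t)) \<noteq> 0 then E8_adj s t else \<not> E8_adj s t)"

definition Gw_compl_adj :: "(vec8 set set \<Rightarrow> vec8) \<Rightarrow> vec8 set \<Rightarrow> vec8 set \<Rightarrow> bool" where
  "Gw_compl_adj w s t \<longleftrightarrow> s \<noteq> t \<and> \<not> Gw_adj w s t"

definition graph_iso ::
  "'a set \<Rightarrow> ('a \<Rightarrow> 'a \<Rightarrow> bool) \<Rightarrow> 'b set \<Rightarrow> ('b \<Rightarrow> 'b \<Rightarrow> bool) \<Rightarrow> bool" where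
  "graph_iso V1 E1 V2 E2 \<longleftrightarrow>
     (\<exists>f. bij_betw f V1 V2 \<and> (\<forall>s\<in>V1. \<forall>t\<in>V1. E1 s t \<longleftrightarrow> E2 (f s) (f t)))"

text \<open>F_2^8 is represented by subsets of {0..<8}; addition is symmetric difference.\<close>

definition symdiff :: "nat set \<Rightarrow> nat set \<Rightarrow> nat set" where
  "symdiff A B = (A - B) \<union> (B - A)"

definition all_ones :: "nat set" where
  "all_ones = {..<8}"

definition even_vec :: "nat set \<Rightarrow> bool" where
  "even_vec x \<longleftrightarrow> x \<subseteq> {..<8} \<and> even (card x)"

definition FH_verts :: "nat set set set" where
  "FH_verts = {{x, symdiff all_ones x} | x. even_vec x}"

definition FH_adj :: "nat set set \<Rightarrow> nat set set \<Rightarrow> bool" where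
  "FH_adj P Q \<longleftrightarrow> (\<exists>x y. P = {x, symdiff all_ones x} \<and> Q = {y, symdiff all_ones y} \<and>
      (card (symdiff x y) = 2 \<or> card (symdiff (symdiff x y) all_ones) = 2))"

definition FH_indep8 :: "nat set set set \<Rightarrow> bool" where
  "FH_indep8 S \<longleftrightarrow> S \<subseteq> FH_verts \<and> card S = 8 \<and> (\<forall>P\<in>S. \<forall>Q\<in>S. \<not> FH_adj P Q)"

text \<open>Action of (translation by a, even permutation p) of the group Z_2^6 x A_8:
  the coordinate permutation p followed by translation by a.\<close>

definition FH_act :: "nat set \<Rightarrow> (nat \<Rightarrow> nat) \<Rightarrow> nat set set \<Rightarrow> nat set set" where
  "FH_act a p P = (\<lambda>x. symdiff (p ` x) a) ` P"

definition FH_group_elt :: "nat set \<Rightarrow> (nat \<Rightarrow> nat) \<Rightarrow> bool" where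
  "FH_group_elt a p \<longleftrightarrow> even_vec a \<and> p permutes {..<8} \<and> evenperm p"

definition FH_orbit :: "nat set set set \<Rightarrow> nat set set set set" where
  "FH_orbit S = {FH_act a p ` S | a p. FH_group_elt a p}"

definition Gamma1_vertex_set :: "nat set set set set \<Rightarrow> bool" where
  "Gamma1_vertex_set Orb \<longleftrightarrow> (\<exists>S. FH_indep8 S \<and> Orb = FH_orbit S) \<and> card Orb = 120"

definition Gamma1_adj :: "nat set set set \<Rightarrow> nat set set set \<Rightarrow> bool" where
  "Gamma1_adj S T \<longleftrightarrow> card (S \<inter> T) = 2"

end

theory Submission
  imports Defs "HOL-Library.Product_Plus"
begin

text \<open>
  Modulo signs the Kronecker products of Pauli matrices form \<open>F_2^6\<close> with the quadratic form of plus
  type whose singular vectors are the symmetric products. The stabilizer \<open>W_i\<close> of a root line in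
  the \<open>i\<close>-th orbit is a maximal totally singular subspace, the 15 subspaces \<open>W_i\<close> are one of the two
  families of such subspaces, and so \<open>W_i \<inter> W_j\<close> has order 2 and \<open>W_i + W_j\<close> has index 2 for
  \<open>i \<noteq> j\<close>. Inner products of \<open>M w_i\<close> and \<open>N w_j\<close> only change by a sign when \<open>M + N\<close> moves
  within a coset of \<open>W_i + W_j\<close>, and orthogonality flips between the two cosets. The switching in
  \<open>G^w\<close> normalises this: the lines of \<open>M w_i\<close> and \<open>N w_j\<close> are nonadjacent in \<open>G^w\<close> exactly when
  \<open>M + N \<in> W_i + W_j\<close>.

  The folded halved 8-cube is the same quadratic space, adjacency meaning that the difference is
  nonsingular, so the independent sets of size 8 are the cosets of maximal totally singular subspaces.
  Transpositions of coordinates are transvections, which swap the two families; hence an orbit of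
  size 120 consists of all cosets of one family. The cosets \<open>M + W_i\<close> and \<open>N + W_j\<close> with
  \<open>i \<noteq> j\<close> meet, and then in two points, exactly when \<open>M + N \<in> W_i + W_j\<close>. Thus
  \<open>M w_i \<mapsto> M + W_i\<close> is the isomorphism, up to a transposition if the orbit belongs to the other
  family.
\<close>

section \<open>The quadratic space of Pauli products\<close>

text \<open>Multiplication of Pauli matrices modulo sign is the Klein four-group. Writing it
  additively lets the product-type instances supply the group structure of
  \<open>pauli3\<close>.\<close>

instantiation pauli :: ab_group_add
begin

definition zero_pauli :: pauli where "zero_pauli = PI"

definition plus_pauli :: "pauli \<Rightarrow> pauli \<Rightarrow> pauli" where
  "plus_pauli a b = (case a of
      PI \<Rightarrow> b
    | PX \<Rightarrow> (case b of PI \<Rightarrow> PX | PX \<Rightarrow> PI | PY \<Rightarrow> PZ | PZ \<Rightarrow> PY)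
    | PY \<Rightarrow> (case b of PI \<Rightarrow> PY | PX \<Rightarrow> PZ | PY \<Rightarrow> PI | PZ \<Rightarrow> PX)
    | PZ \<Rightarrow> (case b of PI \<Rightarrow> PZ | PX \<Rightarrow> PY | PY \<Rightarrow> PX | PZ \<Rightarrow> PI))"

definition uminus_pauli :: "pauli \<Rightarrow> pauli" where "uminus_pauli a = a"

definition minus_pauli :: "pauli \<Rightarrow> pauli \<Rightarrow> pauli" where "minus_pauli a b = a + b"

instance
  by standard
    (auto simp: zero_pauli_def plus_pauli_def uminus_pauli_def minus_pauli_def split: pauli.splits)

end

type_synonym pauli3 = "pauli \<times> pauli \<times> pauli"

lemma pauli_add_self [simp]: "(a::pauli) + a = 0"
  by (cases a) (simp_all add: plus_pauli_def zero_pauli_def)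

lemma pauli3_add_self [simp]: "(M::pauli3) + M = 0"
  by (cases M) (simp add: zero_prod_def)

lemma pauli3_add_cancel [simp]: "(M::pauli3) + (M + N) = N"
  by (metis add.assoc add_0 pauli3_add_self)

lemma pauli3_add_eq_0_iff [simp]: "(M::pauli3) + N = 0 \<longleftrightarrow> M = N"
  by (metis add_0_right pauli3_add_cancel pauli3_add_self)

lemma pauli3_add_add_cancel: "(N::pauli3) + x + (N + y) = x + y" "N + x + (x + y) = N + y"
proof -
  have "N + x + (N + y) = N + (N + (x + y))" "N + x + (x + y) = x + (x + (N + y))" for x y :: pauli3
    by (simp_all only: add_ac)
  then show "N + x + (N + y) = x + y" "N + x + (x + y) = N + y" by (simp_all only: pauli3_add_cancel)
qed

text \<open>An explicit enumeration, so that quantifiers over the group can be evaluated.\<close>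

definition pauli3s :: "pauli3 list" where
  "pauli3s = List.product [PI, PX, PY, PZ] (List.product [PI, PX, PY, PZ] [PI, PX, PY, PZ])"

lemma mem_pauli3s [simp]: "M \<in> set pauli3s"
proof -
  have "a \<in> set [PI, PX, PY, PZ]" for a by (cases a) simp_all
  then show ?thesis unfolding pauli3s_def by (cases M) (simp only: set_product mem_Times_iff fst_conv snd_conv)
qed

text \<open>The quadratic form on \<^typ>\<open>pauli3\<close>: nonsingular means that the Kronecker product squares to
  \<open>-1\<close>. Its polar form says whether two products anticommute.\<close>

definition nonsingular :: "pauli3 \<Rightarrow> bool" where
  "nonsingular = (\<lambda>(a, b, c). (a = PY) \<noteq> ((b = PY) \<noteq> (c = PY)))"

definition span3 :: "pauli3 \<times> pauli3 \<times> pauli3 \<Rightarrow> pauli3 list" where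
  "span3 = (\<lambda>(a, b, c). [0, a, b, a + b, c, a + c, b + c, a + b + c])"

text \<open>Bilinearity of the polar form B(x, y) = q(x + y) + q(x) + q(y), namely B(P + Q, m) =
  B(P, m) + B(Q, m). Here q is \<open>nonsingular\<close>, and inequality of truth values is
  addition in F_2.\<close>

lemma nonsingular_polar_add:
  "(nonsingular (P + Q + m) \<noteq> nonsingular (P + Q)) \<longleftrightarrow>
   ((nonsingular (P + m) \<noteq> nonsingular P) \<noteq> (nonsingular (Q + m) \<noteq> nonsingular Q)) \<noteq> nonsingular m"
proof -
  \<comment> \<open>On a single factor, being \<open>PY\<close> is itself a quadratic form, so its
    value on a sum of three is the parity of the six values on the summands and their pairwise
    sums.\<close>
  have *: "(a + b + c = PY) \<longleftrightarrow>
      (\<not> ((a + b = PY) = ((a + c = PY) = ((b + c = PY) = ((a = PY) = ((b = PY) = (c = PY)))))))" for a b c :: pauli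
    by (cases a; cases b; cases c) (simp_all add: plus_pauli_def zero_pauli_def)
  have bool_xor: "((a = b) = c) = (a = (b = c))" "(a = b) = (b = a)" "(a = (b = c)) = (b = (a = c))"
    "(a = (a = b)) = b" "(a = a) = True" "(a = True) = a" "((\<not> a) = b) = (\<not> (a = b))" "(a = (\<not> b)) = (\<not> (a = b))"
    "(\<not> \<not> a) = a" for a b c :: bool
    by blast+
  obtain P1 P2 P3 Q1 Q2 Q3 m1 m2 m3 where "P = (P1, P2, P3)" "Q = (Q1, Q2, Q3)" "m = (m1, m2, m3)"
    by (metis prod_cases3)
  then show ?thesis
    by (simp only: nonsingular_def prod.case plus_prod_def fst_conv snd_conv * bool_xor)
qed

text \<open>For nonsingular \<open>t\<close> and singular \<open>M\<close> this is M + B(M, t) t,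
  because then q(M + t) = 1 + B(M, t).\<close>

definition transvection :: "pauli3 \<Rightarrow> pauli3 \<Rightarrow> pauli3" where
  "transvection t M = (if nonsingular (M + t) then M else M + t)"

section \<open>Pauli products acting on integer octuples\<close>

text \<open>Nested pairs mirror the tensor decomposition of R^8, the outermost pair belonging to the
  first Kronecker factor, and they can be evaluated on concrete data.\<close>

type_synonym oct = "((int \<times> int) \<times> (int \<times> int)) \<times> ((int \<times> int) \<times> (int \<times> int))"

fun pauli_act :: "pauli \<Rightarrow> 'a::ab_group_add \<times> 'a \<Rightarrow> 'a \<times> 'a" where
  "pauli_act PI (x, y) = (x, y)"
| "pauli_act PX (x, y) = (y, x)"
| "pauli_act PY (x, y) = (- y, x)"
| "pauli_act PZ (x, y) = (x, - y)"

definition tensor_act :: "('a \<Rightarrow> 'a) \<Rightarrow> pauli \<Rightarrow> 'a::ab_group_add \<times> 'a \<Rightarrow> 'a \<times> 'a" where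
  "tensor_act f M = (\<lambda>(x, y). pauli_act M (f x, f y))"

definition oct_act :: "pauli3 \<Rightarrow> oct \<Rightarrow> oct" where
  "oct_act = (\<lambda>(M1, M2, M3). tensor_act (tensor_act (pauli_act M3) M2) M1)"

definition dot_pair :: "('a \<Rightarrow> 'a \<Rightarrow> int) \<Rightarrow> 'a \<times> 'a \<Rightarrow> 'a \<times> 'a \<Rightarrow> int" where
  "dot_pair f = (\<lambda>(x, y) (x', y'). f x x' + f y y')"

definition oct_inner :: "oct \<Rightarrow> oct \<Rightarrow> int" where
  "oct_inner = dot_pair (dot_pair (dot_pair (*)))"

lemma pauli_act_uminus: "pauli_act M (- z) = - pauli_act M z"
  by (cases M; cases z) simp_all

lemma pauli_act_add:
  "(\<forall>z. pauli_act M (pauli_act N z) = pauli_act (M + N) z) \<or>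
   (\<forall>z. pauli_act M (pauli_act N z) = - pauli_act (M + N) z)"
  by (cases M; cases N) (simp_all add: plus_pauli_def zero_pauli_def)

lemma tensor_act_uminus:
  assumes "\<And>x. f (- x) = - f x"
  shows "tensor_act f M (- z) = - tensor_act f M z"
  by (cases M; cases z) (simp_all add: tensor_act_def assms)

text \<open>The sign has to be uniform in \<open>z\<close>: both halves of a pair then acquire the
  same sign, which can be pulled out of the tensor product.\<close>

lemma tensor_act_add:
  assumes odd: "\<And>x. f (- x) = - f x"
    and fg: "(\<forall>z. f (g z) = h z) \<or> (\<forall>z. f (g z) = - h z)"
  shows "(\<forall>z. tensor_act f M (tensor_act g N z) = tensor_act h (M + N) z) \<or>
         (\<forall>z. tensor_act f M (tensor_act g N z) = - tensor_act h (M + N) z)"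
  using fg
  by (elim disjE; cases M; cases N) (simp_all add: tensor_act_def plus_pauli_def zero_pauli_def odd)

lemma oct_act_uminus: "oct_act M (- x) = - oct_act M x"
  by (cases M) (simp add: oct_act_def tensor_act_uminus pauli_act_uminus)

lemma oct_act_add:
  "oct_act M (oct_act N x) = oct_act (M + N) x \<or> oct_act M (oct_act N x) = - oct_act (M + N) x"
proof -
  obtain M1 M2 M3 N1 N2 N3 where "M = (M1, M2, M3)" "N = (N1, N2, N3)"
    by (metis prod_cases3)
  then show ?thesis
    using tensor_act_add[of "tensor_act (pauli_act M3) M2", OF tensor_act_uminus[of "pauli_act M3", OF pauli_act_uminus]
        tensor_act_add[OF pauli_act_uminus pauli_act_add[of M3 N3], of M2 N2], of M1 N1]
    by (auto simp: oct_act_def simp del: split_paired_All)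
qed

lemma oct_act_0 [simp]: "oct_act 0 x = x"
proof -
  obtain a b c d e f g h where "x = (((a, b), (c, d)), ((e, f), (g, h)))" by (metis surj_pair)
  then show ?thesis by (simp add: oct_act_def tensor_act_def zero_prod_def zero_pauli_def)
qed

lemma oct_inner_uminus [simp]:
  "oct_inner (- x) y = - oct_inner x y" "oct_inner x (- y) = - oct_inner x y"
  by (auto simp: oct_inner_def dot_pair_def case_prod_beta)

lemma oct_inner_act: "oct_inner (oct_act M x) (oct_act M y) = oct_inner x y"
proof -
  have D: "dot_pair f (tensor_act g M x) (tensor_act g M y) = dot_pair f x y"
    if "\<And>x y. f (- x) y = - f x y" "\<And>x y. f x (- y) = - f x y" "\<And>x y. f (g x) (g y) = f x y"
    for f :: "'a::ab_group_add \<Rightarrow> 'a \<Rightarrow> int" and g M x y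
    by (cases M; cases x; cases y) (simp_all add: that dot_pair_def tensor_act_def)
  have P: "dot_pair (*) (pauli_act M x) (pauli_act M y) = dot_pair (*) x y" for M x y
    by (cases M; cases x; cases y) (simp_all add: dot_pair_def)
  have U: "dot_pair f (- x) y = - dot_pair f x y" "dot_pair f x (- y) = - dot_pair f x y"
    if "\<And>x y. f (- x) y = - f x y" "\<And>x y. f x (- y) = - f x y"
    for f :: "'a::ab_group_add \<Rightarrow> 'a \<Rightarrow> int" and x y
    by (cases x; cases y; simp add: that dot_pair_def)+
  show ?thesis
    by (cases M) (auto simp: oct_inner_def oct_act_def intro!: D P U)
qed

text \<open>\<open>M\<close> is an isometry and, up to sign, its own inverse; signs do not affect
  orthogonality, so \<open>M\<close> can move to the other argument.\<close>

lemma oct_inner_act_eq_0_iff: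
  "oct_inner (oct_act M x) (oct_act N y) = 0 \<longleftrightarrow> oct_inner x (oct_act (M + N) y) = 0"
proof -
  have "oct_inner (oct_act M x) (oct_act N y)
      = oct_inner (oct_act M (oct_act M x)) (oct_act M (oct_act N y))"
    by (simp add: oct_inner_act)
  then show ?thesis using oct_act_add[of M M x] oct_act_add[of M N y] by auto
qed

definition vec_of :: "oct \<Rightarrow> vec8" where
  "vec_of = (\<lambda>(((a, b), (c, d)), ((e, f), (g, h))) k. if k < 8 then [a, b, c, d, e, f, g, h] ! k else 0)"

lemma lessThan_8: "{..<8} = {0, 1, 2, 3, 4, 5, 6, 7::nat}"
  by auto

lemma kron3_apply_vec_of: "kron3_apply M (vec_of x) = vec_of (oct_act M x)"
proof -
  obtain a b c d e f g h where x: "x = (((a, b), (c, d)), ((e, f), (g, h)))" by (metis surj_pair)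
  have "\<forall>k\<in>{..<8}. kron3_apply M (vec_of x) k = vec_of (oct_act M x) k"
    unfolding lessThan_8
    by (cases M, rename_tac M1 M2 M3, case_tac M1; case_tac M2; case_tac M3;
        simp add: x kron3_apply_def kron3_entry_def vec_of_def oct_act_def tensor_act_def lessThan_8)
  then show ?thesis
    by (auto simp: fun_eq_iff kron3_apply_def vec_of_def split: prod.splits)
qed

lemma inner8_vec_of: "inner8 (vec_of x) (vec_of y) = oct_inner x y"
  by (auto simp: inner8_def vec_of_def oct_inner_def dot_pair_def lessThan_8 split: prod.splits)

lemma vec_of_uminus: "vec_of (- x) = - vec_of x"
proof -
  obtain a b c d e f g h where x: "x = (((a, b), (c, d)), ((e, f), (g, h)))" by (metis surj_pair)
  have "\<forall>k\<in>{..<8}. vec_of (- x) k = (- vec_of x) k"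
    unfolding lessThan_8 by (simp add: x vec_of_def)
  then show ?thesis
    by (auto simp: fun_eq_iff vec_of_def x)
qed

section \<open>Roots as octuples\<close>

text \<open>The short list contains the \<open>\<plusminus> e_i \<plusminus> e_j\<close>, the long list the sign vectors; \<open>root_list\<close> tests
  membership without a search through these lists.\<close>

fun oct_of :: "int list \<Rightarrow> oct" where
  "oct_of [a, b, c, d, e, f, g, h] = (((a, b), (c, d)), ((e, f), (g, h)))"
| "oct_of _ = 0"

definition octs_short :: "oct list" where
  "octs_short = map (\<lambda>(i, j, s, t). oct_of (map (\<lambda>k. if k = i then s else if k = j then t else 0) [0..<8]))
     (filter (\<lambda>(i, j, s, t). i < j)
       (List.product [0..<8] (List.product [0..<8] (List.product [1, -1] [1, -1]))))"

definition octs_long :: "oct list" where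
  "octs_long = [oct_of x. x \<leftarrow> product_lists (replicate 8 [1, -1]), prod_list x = 1]"

fun oct_list :: "oct \<Rightarrow> int list" where
  "oct_list (((a, b), (c, d)), ((e, f), (g, h))) = [a, b, c, d, e, f, g, h]"

definition root_list :: "int list \<Rightarrow> bool" where
  "root_list l \<longleftrightarrow>
     (case filter (\<lambda>k. l ! k \<noteq> 0) [0..<8] of
        [i, j] \<Rightarrow> l ! i \<in> set [1, - 1] \<and> l ! j \<in> set [1, - 1]
      | _ \<Rightarrow> (\<forall>a\<in>set l. a \<in> set [1, - 1]) \<and> prod_list l = 1)"

lemma vec_of_oct_of:
  assumes "length l = 8"
  shows "vec_of (oct_of l) = (\<lambda>k. if k < 8 then l ! k else 0)"
proof -
  obtain a b c d e f g h where "l = [a, b, c, d, e, f, g, h]"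
    using assms by (auto simp: numeral_eq_Suc length_Suc_conv)
  then show ?thesis by (simp add: vec_of_def fun_eq_iff)
qed

lemma vec_of_eq_iff [simp]: "vec_of x = vec_of y \<longleftrightarrow> x = y"
proof
  assume eq: "vec_of x = vec_of y"
  obtain a b c d e f g h where x: "x = (((a, b), (c, d)), ((e, f), (g, h)))" by (metis surj_pair)
  obtain a' b' c' d' e' f' g' h' where y: "y = (((a', b'), (c', d')), ((e', f'), (g', h')))"
    by (metis surj_pair)
  have "\<forall>k\<in>{..<8}. vec_of x k = vec_of y k" using eq by simp
  then show "x = y" unfolding lessThan_8 by (simp add: x y vec_of_def)
qed simp

lemma vec_of_oct_of_map:
  assumes "\<And>k. k \<ge> 8 \<Longrightarrow> x k = 0"
  shows "vec_of (oct_of (map x [0..<8])) = x"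
  using assms by (subst vec_of_oct_of) (auto simp: fun_eq_iff)

lemma E8_roots_subset: "E8_roots \<subseteq> vec_of ` (set octs_short \<union> set octs_long)"
proof -
  have short: "x \<in> vec_of ` set octs_short"
    if "i < j" "j < 8" "s \<in> {1, - 1}" "t \<in> {1, - 1}"
      "x = (\<lambda>k. if k = i then s else if k = j then t else 0)" for x i j s t
  proof
    show "x = vec_of (oct_of (map x [0..<8]))"
      using that by (subst vec_of_oct_of_map) auto
    show "oct_of (map x [0..<8]) \<in> set octs_short"
      unfolding octs_short_def set_map using that
      by (intro image_eqI[of _ _ "(i, j, s, t)"]) (auto simp del: upt_Suc)
  qed
  have long: "x \<in> vec_of ` set octs_long"
    if x: "\<forall>k<8. x k \<in> {1, - 1}" "\<forall>k\<ge>8. x k = 0" "(\<Prod>k<8. x k) = 1" for x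
  proof
    show "x = vec_of (oct_of (map x [0..<8]))"
      using x by (subst vec_of_oct_of_map) auto
    have "prod_list (map x [0..<8]) = 1"
      using x(3) prod.distinct_set_conv_list[of "[0..<8]" x] by (simp add: atLeast0LessThan del: upt_Suc)
    moreover have "map x [0..<8] \<in> set (product_lists (replicate 8 [1, - 1]))"
      using x(1) by (auto simp: product_lists_set list_all2_conv_all_nth)
    ultimately show "oct_of (map x [0..<8]) \<in> set octs_long"
      unfolding octs_long_def by (auto simp del: upt_Suc)
  qed
  show ?thesis
  proof
    fix x assume "x \<in> E8_roots"
    then show "x \<in> vec_of ` (set octs_short \<union> set octs_long)"
      unfolding E8_roots_def image_Un
      by (elim UnE CollectE exE conjE) (erule (4) short[THEN UnI1], erule (2) long[THEN UnI2])
  qed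
qed

lemma root_list_imp_root:
  assumes "root_list (oct_list x)"
  shows "vec_of x \<in> E8_roots"
proof -
  define l where "l = oct_list x"
  have len: "length l = 8" and x: "x = oct_of l"
    unfolding l_def by (cases x rule: oct_list.cases; simp)+
  define I where "I = filter (\<lambda>k. l ! k \<noteq> 0) [0..<8]"
  have I: "set I = {k. k < 8 \<and> l ! k \<noteq> 0}" "sorted_wrt (<) I"
    unfolding I_def by (auto simp: sorted_wrt_filter simp del: upt_Suc)
  show ?thesis
  proof (cases "\<exists>i j. I = [i, j]")
    case True
    then obtain i j where ij: "I = [i, j]" by blast
    then have "i < j" "j < 8" "l ! i \<in> {1, - 1}" "l ! j \<in> {1, - 1}"
      using I assms by (auto simp: root_list_def l_def[symmetric] I_def[symmetric])
    moreover have "vec_of x = (\<lambda>k. if k = i then l ! i else if k = j then l ! j else 0)"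
      using I(1) ij \<open>i < j\<close> \<open>j < 8\<close> by (auto simp: x vec_of_oct_of[OF len] fun_eq_iff)
    ultimately show ?thesis unfolding E8_roots_def by blast
  next
    case False
    then have "(\<forall>a\<in>set l. a \<in> {1, - 1}) \<and> prod_list l = 1"
      using assms unfolding root_list_def l_def[symmetric] I_def[symmetric]
      by (auto split: list.splits)
    moreover from this have "(\<Prod>k<8. l ! k) = 1"
      using len by (simp add: prod.list_conv_set_nth atLeast0LessThan)
    ultimately show ?thesis
      unfolding E8_roots_def using len by (simp add: x vec_of_oct_of)
  qed
qed

section \<open>Root lines and their orbits\<close>

definition line :: "oct \<Rightarrow> vec8 set" where
  "line x = {vec_of x, - vec_of x}"

lemma line_eq_iff: "line x = line y \<longleftrightarrow> x = y \<or> x = - y"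
  by (auto simp: line_def doubleton_eq_iff vec_of_uminus[symmetric])

lemma E8_adj_line: "E8_adj (line x) (line y) \<longleftrightarrow> oct_inner x y = 0"
  by (auto simp: E8_adj_def line_def vec_of_uminus[symmetric] inner8_vec_of)

text \<open>On lines the sign in \<open>oct_act_add\<close> disappears, so \<open>pauli3\<close>
  acts as a group.\<close>

lemma line_act_act: "line (oct_act M (oct_act N x)) = line (oct_act (M + N) x)"
  using oct_act_add[of M N x] by (auto simp: line_eq_iff)

lemma sigma_line: "sigma M (line x) = line (oct_act M x)"
  by (simp add: sigma_def line_def vec_of_uminus[symmetric] kron3_apply_vec_of oct_act_uminus)

lemma L_orbit_line: "L_orbit (line x) = range (\<lambda>M. line (oct_act M x))"
  by (auto simp: L_orbit_def sigma_line)

lemma L_orbit_line_act: "L_orbit (line (oct_act N x)) = L_orbit (line x)"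
proof -
  have "range (\<lambda>M. line (oct_act (M + N) x)) = range (\<lambda>M. line (oct_act M x))"
    by (metis (no_types, lifting) UNIV_I diff_add_cancel image_eqI image_subset_iff subsetI subset_antisym)
  then show ?thesis by (simp add: L_orbit_line line_act_act)
qed

section \<open>The two families of maximal totally singular subspaces\<close>

text \<open>One representative \<open>r\<close> of every orbit of \<open>L\<close>, with its stabilizer modulo sign. The stabilizers
  are one of the two families of maximal totally singular subspaces of \<^typ>\<open>pauli3\<close>; the other
  family is \<open>opposite_spaces\<close>.\<close>

definition frames :: "(oct \<times> pauli3 list) list" where
  "frames = map (\<lambda>(r, B). (r, span3 B)) [
    ((((1, 1), (0, 0)), ((0, 0), (0, 0))),
      ((PI, PI, PX), (PI, PZ, PI), (PZ, PI, PI))),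
    ((((1, 0), (1, 0)), ((0, 0), (0, 0))),
      ((PI, PI, PZ), (PI, PX, PI), (PZ, PI, PI))),
    ((((1, 0), (0, 1)), ((0, 0), (0, 0))),
      ((PI, PX, PX), (PI, PY, PY), (PZ, PI, PI))),
    ((((1, 0), (0, 0)), ((1, 0), (0, 0))),
      ((PI, PI, PZ), (PI, PZ, PI), (PX, PI, PI))),
    ((((1, 0), (0, 0)), ((0, 1), (0, 0))),
      ((PI, PZ, PI), (PX, PI, PX), (PY, PI, PY))),
    ((((1, 0), (0, 0)), ((0, 0), (1, 0))),
      ((PI, PI, PZ), (PX, PX, PI), (PY, PY, PI))),
    ((((1, 0), (0, 0)), ((0, 0), (0, 1))),
      ((PI, PZ, PZ), (PX, PX, PX), (PY, PX, PY))),
    ((((1, 1), (1, 1)), ((1, 1), (1, 1))),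
      ((PI, PI, PX), (PI, PX, PI), (PX, PI, PI))),
    ((((1, 1), (1, 1)), ((1, 1), (-1, -1))),
      ((PI, PI, PX), (PX, PZ, PI), (PY, PY, PI))),
    ((((1, 1), (1, 1)), ((1, -1), (1, -1))),
      ((PI, PX, PI), (PX, PI, PZ), (PY, PI, PY))),
    ((((1, 1), (1, 1)), ((1, -1), (-1, 1))),
      ((PI, PX, PX), (PX, PY, PY), (PY, PY, PZ))),
    ((((1, 1), (1, -1)), ((1, 1), (1, -1))),
      ((PI, PX, PZ), (PI, PY, PY), (PX, PI, PI))),
    ((((1, 1), (1, -1)), ((1, 1), (-1, 1))),
      ((PI, PZ, PX), (PX, PI, PX), (PY, PX, PY))),
    ((((1, 1), (1, -1)), ((1, -1), (1, 1))),
      ((PI, PX, PZ), (PX, PI, PZ), (PY, PY, PX))),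
    ((((1, 1), (1, -1)), ((1, -1), (-1, -1))),
      ((PI, PY, PY), (PX, PX, PX), (PY, PI, PY)))]"

definition opposite_spaces :: "pauli3 list list" where
  "opposite_spaces = map span3 [
    ((PI, PI, PX), (PI, PX, PI), (PZ, PI, PI)),
    ((PI, PI, PX), (PI, PZ, PI), (PX, PI, PI)),
    ((PI, PI, PX), (PX, PX, PI), (PY, PY, PI)),
    ((PI, PI, PZ), (PI, PX, PI), (PX, PI, PI)),
    ((PI, PI, PZ), (PI, PZ, PI), (PZ, PI, PI)),
    ((PI, PI, PZ), (PX, PZ, PI), (PY, PY, PI)),
    ((PI, PX, PI), (PX, PI, PX), (PY, PI, PY)),
    ((PI, PX, PX), (PI, PY, PY), (PX, PI, PI)),
    ((PI, PX, PX), (PX, PI, PX), (PY, PY, PZ)),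
    ((PI, PX, PZ), (PI, PY, PY), (PZ, PI, PI)),
    ((PI, PX, PZ), (PX, PY, PY), (PY, PY, PX)),
    ((PI, PY, PY), (PX, PX, PZ), (PY, PI, PY)),
    ((PI, PZ, PI), (PX, PI, PZ), (PY, PI, PY)),
    ((PI, PZ, PX), (PX, PX, PZ), (PY, PX, PY)),
    ((PI, PZ, PZ), (PX, PI, PZ), (PY, PX, PY))]"

text \<open>Both directions serve an induction over transpositions, which alternates between the
  families. Containment is enough here; equality follows later by counting.\<close>

lemma transvection_swaps:
  "\<forall>t\<in>set pauli3s. nonsingular t \<longrightarrow>
     (\<forall>(r, W)\<in>set frames. \<exists>W'\<in>set opposite_spaces. \<forall>M\<in>set W. transvection t M \<in> set W') \<and>
     (\<forall>W'\<in>set opposite_spaces. \<exists>(r, W)\<in>set frames. \<forall>M\<in>set W'. transvection t M \<in> set W)"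
  by code_simp

text \<open>A set of eight pairwise compatible elements containing \<open>0\<close> contains independent \<open>a\<close>, \<open>b\<close>, \<open>c\<close>, and
  these already leave only one maximal totally singular subspace. Shrinking the candidate lists
  after each choice keeps the search short.\<close>

lemma classification_check:
  "let Ws = map snd frames @ opposite_spaces; A = filter (\<lambda>a. \<not> nonsingular a) pauli3s in
   \<forall>a\<in>set A. a \<noteq> 0 \<longrightarrow>
    (let A = filter (\<lambda>x. \<not> nonsingular (x + a)) A; Ws = filter (\<lambda>W. a \<in> set W) Ws in
     \<forall>b\<in>set A. b \<notin> set [0, a] \<longrightarrow>
      (let A = filter (\<lambda>x. \<not> nonsingular (x + b)) A; Ws = filter (\<lambda>W. b \<in> set W) Ws in
       \<forall>c\<in>set A. c \<notin> set [0, a, b, a + b] \<longrightarrow>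
        (\<exists>W\<in>set Ws. \<forall>x\<in>set A. \<not> nonsingular (x + c) \<longrightarrow> x \<in> set W)))"
  by code_simp

text \<open>Outside \<open>W\<close> the image of \<open>r\<close> is orthogonal to
  \<open>r\<close>. Hence \<open>W\<close> is exactly the stabilizer of the line of
  \<open>r\<close>, and the distinct lines of an orbit form an orthogonal frame.\<close>

lemma same_frame_check:
  "\<forall>(r, W)\<in>set frames. distinct W \<and> length W = 8 \<and> oct_inner r r \<noteq> 0 \<and>
     (\<forall>M\<in>set W. \<not> nonsingular M) \<and>
     (\<forall>M\<in>set pauli3s. if M \<in> set W then oct_act M r = r \<or> oct_act M r = - r
        else oct_inner r (oct_act M r) = 0)"
  by code_simp

text \<open>\<open>m\<close> spans the intersection of \<open>W\<close> and \<open>W'\<close>. The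
  last conjunct puts the hyperplane orthogonal to \<open>m\<close> under the polar form inside the
  sum of \<open>W\<close> and \<open>W'\<close>; the existential over \<open>P\<close> says that
  orthogonality to \<open>r\<close> is not constant on the orbit of \<open>r'\<close>.\<close>

lemma distinct_frames_check:
  "\<forall>(r, W)\<in>set frames. \<forall>(r', W')\<in>set frames. r \<noteq> r' \<longrightarrow>
     (\<exists>m\<in>set W. m \<in> set W' \<and> m \<noteq> 0 \<and> (\<forall>a\<in>set W. a \<in> set W' \<longrightarrow> a = 0 \<or> a = m) \<and>
       (\<exists>P\<in>set pauli3s. (oct_inner r (oct_act P r') = 0) \<noteq> (oct_inner r r' = 0)) \<and>
       (\<forall>P\<in>set pauli3s. nonsingular (P + m) = nonsingular P \<longrightarrow> (\<exists>a\<in>set W. P + a \<in> set W')))"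
  by code_simp

lemma act_frames_root_check:
  "\<forall>(r, W)\<in>set frames. \<forall>M\<in>set pauli3s. root_list (oct_list (oct_act M r))"
  by code_simp

text \<open>Signed permutations keep the two kinds of roots apart, and the first seven
  representatives are the short ones; splitting the list shortens the search.\<close>

lemma short_roots_check:
  "\<forall>x\<in>set octs_short. \<exists>(r, W)\<in>set (take 7 frames). \<exists>M\<in>set pauli3s.
     let y = oct_act M r in y = x \<or> y = - x"
  by code_simp

lemma long_roots_check:
  "\<forall>x\<in>set octs_long. \<exists>(r, W)\<in>set (drop 7 frames). \<exists>M\<in>set pauli3s.
     let y = oct_act M r in y = x \<or> y = - x"
  by code_simp

section \<open>Frames and their stabilizers\<close>

definition stab :: "oct \<Rightarrow> pauli3 set" where
  "stab r = {M. line (oct_act M r) = line r}"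

text \<open>The subspace sum \<open>stab r + stab r'\<close>: as every element is its own inverse,
  \<open>P + a\<close> is the second summand of \<open>P\<close>.\<close>

definition sum_stab :: "oct \<Rightarrow> oct \<Rightarrow> pauli3 set" where
  "sum_stab r r' = {P. \<exists>a\<in>stab r. P + a \<in> stab r'}"

definition reps :: "oct set" where
  "reps = fst ` set frames"

lemma zero_in_stab [simp]: "0 \<in> stab r"
  by (simp add: stab_def)

lemma line_act_cong: "line x = line y \<Longrightarrow> line (oct_act M x) = line (oct_act M y)"
  by (auto simp: line_eq_iff oct_act_uminus)

lemma stab_add: "a \<in> stab r \<Longrightarrow> b \<in> stab r \<Longrightarrow> a + b \<in> stab r"
  unfolding stab_def using line_act_cong[of "oct_act b r" r a] by (simp add: line_act_act)

lemma stab_add_iff: "a \<in> stab r \<Longrightarrow> a + b \<in> stab r \<longleftrightarrow> b \<in> stab r"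
  using stab_add[of a r b] stab_add[of a r "a + b"] by auto

lemma set_frame:
  assumes "(r, W) \<in> set frames"
  shows "set W = stab r"
proof -
  have *: "oct_inner r r \<noteq> 0"
    "if M \<in> set W then oct_act M r = r \<or> oct_act M r = - r else oct_inner r (oct_act M r) = 0" for M
    using same_frame_check assms mem_pauli3s by fast+
  have "M \<in> set W \<longleftrightarrow> M \<in> stab r" for M
    unfolding stab_def line_eq_iff using *(1) *(2)[of M] by (auto split: if_splits)
  then show ?thesis by blast
qed

lemma reps_frame:
  assumes "r \<in> reps"
  obtains W where "(r, W) \<in> set frames" "set W = stab r"
  using assms set_frame by (auto simp: reps_def)

lemma reps_properties:
  assumes "r \<in> reps"
  shows card_stab: "card (stab r) = 8"
    and stab_singular: "M \<in> stab r \<Longrightarrow> \<not> nonsingular M"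
    and inner_self_nonzero: "oct_inner r r \<noteq> 0"
    and inner_act_eq_0_iff: "oct_inner r (oct_act M r) = 0 \<longleftrightarrow> M \<notin> stab r"
proof -
  obtain W where W: "(r, W) \<in> set frames" "set W = stab r" using assms by (rule reps_frame)
  have *: "distinct W" "length W = 8" "oct_inner r r \<noteq> 0" "\<forall>M\<in>set W. \<not> nonsingular M"
    "if M \<in> set W then oct_act M r = r \<or> oct_act M r = - r else oct_inner r (oct_act M r) = 0" for M
    using same_frame_check W(1) mem_pauli3s by fast+
  show "card (stab r) = 8" using *(1,2) W(2) by (metis distinct_card)
  show "oct_inner r r \<noteq> 0" by fact
  show "\<not> nonsingular M" if "M \<in> stab r" using that *(4) W(2) by blast
  show "oct_inner r (oct_act M r) = 0 \<longleftrightarrow> M \<notin> stab r"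
    using *(3) *(5)[of M] W(2) by auto
qed

lemma distinct_reps:
  assumes "r \<in> reps" "r' \<in> reps" "r \<noteq> r'"
  obtains m P where "m \<noteq> 0" "stab r \<inter> stab r' = {0, m}"
    "(oct_inner r (oct_act P r') = 0) \<noteq> (oct_inner r r' = 0)"
    "\<And>P. P \<in> sum_stab r r' \<longleftrightarrow> (nonsingular (P + m) \<longleftrightarrow> nonsingular P)"
proof -
  obtain W W' where W: "(r, W) \<in> set frames" "set W = stab r" and W': "(r', W') \<in> set frames" "set W' = stab r'"
    using assms(1,2) by (metis reps_frame)
  have "\<exists>m\<in>set W. m \<in> set W' \<and> m \<noteq> 0 \<and> (\<forall>a\<in>set W. a \<in> set W' \<longrightarrow> a = 0 \<or> a = m) \<and>
       (\<exists>P\<in>set pauli3s. (oct_inner r (oct_act P r') = 0) \<noteq> (oct_inner r r' = 0)) \<and>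
       (\<forall>P\<in>set pauli3s. nonsingular (P + m) = nonsingular P \<longrightarrow> (\<exists>a\<in>set W. P + a \<in> set W'))"
    using distinct_frames_check W(1) W'(1) assms(3) by fast
  then obtain m P where m: "m \<in> stab r" "m \<in> stab r'" "m \<noteq> 0" "\<forall>a\<in>stab r. a \<in> stab r' \<longrightarrow> a = 0 \<or> a = m"
    and P: "(oct_inner r (oct_act P r') = 0) \<noteq> (oct_inner r r' = 0)"
    and perp: "\<And>P. nonsingular (P + m) = nonsingular P \<Longrightarrow> P \<in> sum_stab r r'"
    unfolding W(2) W'(2) sum_stab_def using mem_pauli3s by blast
  \<comment> \<open>The reverse inclusion: \<open>a\<close> and \<open>P + a\<close> each share a
    totally singular subspace with \<open>m\<close>, so both are orthogonal to \<open>m\<close>, and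
    by bilinearity so is \<open>P\<close>.\<close>
  have "nonsingular (P + m) \<longleftrightarrow> nonsingular P" if Q: "P \<in> sum_stab r r'" for P
  proof -
    obtain a where a: "a \<in> stab r" "P + a \<in> stab r'" using Q by (auto simp: sum_stab_def)
    have "\<not> nonsingular a" "\<not> nonsingular (a + m)" "\<not> nonsingular (P + a)" "\<not> nonsingular (P + a + m)"
      "\<not> nonsingular m"
      using a m assms stab_singular stab_add by blast+
    then show ?thesis using nonsingular_polar_add[of P a m] by simp
  qed
  then have "Q \<in> sum_stab r r' \<longleftrightarrow> (nonsingular (Q + m) \<longleftrightarrow> nonsingular Q)" for Q
    using perp by blast
  moreover have "stab r \<inter> stab r' = {0, m}" using m by auto
  ultimately show ?thesis using m(3) P that by blast
qed

text \<open>\<open>sum_stab r r'\<close> is the kernel of the linear functional that the polar form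
  attaches to \<open>m\<close>.\<close>

lemma sum_stab_add:
  assumes "r \<in> reps" "r' \<in> reps" "r \<noteq> r'"
  shows "P + Q \<in> sum_stab r r' \<longleftrightarrow> (P \<in> sum_stab r r' \<longleftrightarrow> Q \<in> sum_stab r r')"
proof -
  obtain m where m: "stab r \<inter> stab r' = {0, m}"
    "\<And>P. P \<in> sum_stab r r' \<longleftrightarrow> (nonsingular (P + m) \<longleftrightarrow> nonsingular P)"
    using distinct_reps[OF assms] by metis
  then have "\<not> nonsingular m" using stab_singular[OF assms(1)] by blast
  then show ?thesis using m(2) nonsingular_polar_add[of P Q m] by auto
qed

text \<open>Split \<open>Q\<close> as \<open>a + b\<close> with \<open>a\<close> fixing the line of
  \<open>r\<close> and \<open>b\<close> that of \<open>r'\<close>: \<open>a\<close> moves across the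
  inner product and \<open>b\<close> is absorbed.\<close>

lemma oct_inner_add_sum_stab:
  assumes "Q \<in> sum_stab r r'"
  shows "oct_inner r (oct_act (P + Q) r') = 0 \<longleftrightarrow> oct_inner r (oct_act P r') = 0"
proof -
  obtain a where a: "a \<in> stab r" "Q + a \<in> stab r'" using assms by (auto simp: sum_stab_def)
  have "oct_inner r (oct_act (P + Q) r') = 0 \<longleftrightarrow> oct_inner (oct_act a r) (oct_act (P + Q) r') = 0"
    using a(1) by (auto simp: stab_def line_eq_iff)
  also have "\<dots> \<longleftrightarrow> oct_inner r (oct_act (P + (Q + a)) r') = 0"
    by (simp add: oct_inner_act_eq_0_iff add_ac)
  also have "\<dots> \<longleftrightarrow> oct_inner r (oct_act P (oct_act (Q + a) r')) = 0"
    using oct_act_add[of P "Q + a" r'] by auto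
  also have "\<dots> \<longleftrightarrow> oct_inner r (oct_act P r') = 0"
    using a(2) by (auto simp: stab_def line_eq_iff oct_act_uminus)
  finally show ?thesis .
qed

text \<open>Some \<open>R\<close> changes orthogonality and so lies outside
  \<open>sum_stab r r'\<close>. Any other outside element differs from \<open>R\<close> by an
  element of the sum, hence changes it too.\<close>

lemma orthogonality_toggle:
  assumes "r \<in> reps" "r' \<in> reps" "r \<noteq> r'"
  shows "(oct_inner r (oct_act P r') = 0 \<longleftrightarrow> oct_inner r (oct_act Q r') = 0) \<longleftrightarrow> P + Q \<in> sum_stab r r'"
proof -
  obtain R where R: "(oct_inner r (oct_act R r') = 0) \<noteq> (oct_inner r r' = 0)"
    using distinct_reps[OF assms] by metis
  have "(oct_inner r (oct_act P r') = 0) \<longleftrightarrow> (oct_inner r r' = 0 \<longleftrightarrow> P \<in> sum_stab r r')" for P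
  proof (cases "P \<in> sum_stab r r'")
    case True
    then show ?thesis using oct_inner_add_sum_stab[of P r r' 0] by simp
  next
    case False
    moreover have "R \<notin> sum_stab r r'" using R oct_inner_add_sum_stab[of R r r' 0] by auto
    ultimately have "R + P \<in> sum_stab r r'" by (simp add: sum_stab_add[OF assms])
    then have "oct_inner r (oct_act P r') = 0 \<longleftrightarrow> oct_inner r (oct_act R r') = 0"
      using oct_inner_add_sum_stab[of "R + P" r r' R] by simp
    then show ?thesis using False R by simp
  qed
  then show ?thesis by (auto simp: sum_stab_add[OF assms])
qed

lemma line_act_same_rep: "line (oct_act M r) = line (oct_act N r) \<longleftrightarrow> M + N \<in> stab r"
proof
  assume "line (oct_act M r) = line (oct_act N r)"
  then have "line (oct_act M (oct_act M r)) = line (oct_act M (oct_act N r))" by (rule line_act_cong)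
  then show "M + N \<in> stab r" by (simp add: line_act_act stab_def)
next
  assume "M + N \<in> stab r"
  then have "line (oct_act M (oct_act (M + N) r)) = line (oct_act M r)"
    unfolding stab_def by (intro line_act_cong) simp
  then show "line (oct_act M r) = line (oct_act N r)" by (simp add: line_act_act)
qed

text \<open>Stabilizers of size 8 that meet in two elements leave some \<open>Q\<close> in
  \<open>stab r'\<close> but not in \<open>stab r\<close>. If the lines agreed, \<open>Q\<close>
  would preserve the orthogonality status of \<open>r\<close> with itself, yet it sends
  \<open>r\<close> to an orthogonal vector.\<close>

lemma line_act_distinct_reps:
  assumes r: "r \<in> reps" "r' \<in> reps" "r \<noteq> r'"
  shows "line (oct_act M r) \<noteq> line (oct_act N r')"
proof
  assume eq: "line (oct_act M r) = line (oct_act N r')"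
  obtain m where "stab r \<inter> stab r' = {0, m}" using distinct_reps[OF r] by metis
  then have "card (stab r' - stab r) \<noteq> 0"
    using card_stab[OF r(2)] card_Diff_subset_Int[of "stab r'" "stab r"]
    by (auto simp: Int_commute card_insert_if)
  then obtain Q where Q: "Q \<in> stab r'" "Q \<notin> stab r" by (metis DiffE all_not_in_conv card.empty)
  have Qs: "Q \<in> sum_stab r r'" using Q(1) by (auto simp: sum_stab_def intro: bexI[of _ 0])
  have "line r = line (oct_act M (oct_act M r))" by (simp add: line_act_act)
  also have "\<dots> = line (oct_act M (oct_act N r'))"
    using eq by (rule line_act_cong)
  finally have r_eq: "line r = line (oct_act (M + N) r')" by (simp add: line_act_act)
  then have "line (oct_act Q r) = line (oct_act Q (oct_act (M + N) r'))"
    by (rule line_act_cong)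
  then have "line (oct_act Q r) = line (oct_act (M + N + Q) r')" by (simp add: line_act_act add_ac)
  then have "oct_inner r (oct_act Q r) = 0 \<longleftrightarrow> oct_inner r (oct_act (M + N + Q) r') = 0"
    by (auto simp: line_eq_iff)
  also have "\<dots> \<longleftrightarrow> oct_inner r (oct_act (M + N) r') = 0"
    by (rule oct_inner_add_sum_stab[OF Qs])
  also have "\<dots> \<longleftrightarrow> oct_inner r r = 0" using r_eq by (auto simp: line_eq_iff)
  finally show False using inner_act_eq_0_iff[OF r(1)] inner_self_nonzero[OF r(1)] Q(2) by simp
qed

lemma E8_verts_eq: "E8_verts = (\<lambda>(M, r). line (oct_act M r)) ` (UNIV \<times> reps)"
proof (intro equalityI subsetI)
  fix v assume "v \<in> E8_verts"
  then obtain x where x: "x \<in> set octs_short \<union> set octs_long" "v = line x"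
    using E8_roots_subset unfolding E8_verts_def line_def by blast
  obtain r W M where "(r, W) \<in> set frames" "oct_act M r = x \<or> oct_act M r = - x"
  proof (cases "x \<in> set octs_short")
    case True
    show ?thesis using bspec[OF short_roots_check True] that unfolding Let_def by (blast dest: in_set_takeD)
  next
    case False
    then have "x \<in> set octs_long" using x(1) by blast
    from bspec[OF long_roots_check this] show ?thesis using that unfolding Let_def by (blast dest: in_set_dropD)
  qed
  then have "(r, W) \<in> set frames" "line (oct_act M r) = line x"
    using line_eq_iff by blast+
  then show "v \<in> (\<lambda>(M, r). line (oct_act M r)) ` (UNIV \<times> reps)"
    unfolding x(2) reps_def by (intro image_eqI[of _ _ "(M, r)"]) (auto intro: image_eqI[of _ _ "(r, W)"])
next
  fix v assume "v \<in> (\<lambda>(M, r). line (oct_act M r)) ` (UNIV \<times> reps)"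
  then obtain M r where "r \<in> reps" and v: "v = line (oct_act M r)" by auto
  then obtain W where "(r, W) \<in> set frames" using reps_frame by blast
  then have "root_list (oct_list (oct_act M r))"
    using act_frames_root_check mem_pauli3s by fast
  then show "v \<in> E8_verts"
    unfolding E8_verts_def v line_def using root_list_imp_root by blast
qed

section \<open>The complement of the switched graph\<close>

text \<open>A graph with such a parametrization is determined up to isomorphism, because neither condition
  on the right mentions \<open>e\<close>.\<close>

definition coset_model ::
  "(pauli3 \<times> oct \<Rightarrow> 'a) \<Rightarrow> 'a set \<Rightarrow> ('a \<Rightarrow> 'a \<Rightarrow> bool) \<Rightarrow> bool" where
  "coset_model e V E \<longleftrightarrow> V = e ` (UNIV \<times> reps) \<and>
     (\<forall>M N. \<forall>r\<in>reps. \<forall>r'\<in>reps.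
        (e (M, r) = e (N, r') \<longleftrightarrow> r = r' \<and> M + N \<in> stab r) \<and>
        (E (e (M, r)) (e (N, r')) \<longleftrightarrow> r \<noteq> r' \<and> M + N \<in> sum_stab r r'))"

text \<open>Each orbit is parametrized from the root chosen by \<open>w\<close> instead of from
  \<open>r\<close>; relative to this base point the switching removes the dependence on the
  choice.\<close>

lemma Gw_complement_model:
  assumes w: "admissible_w w"
  shows "\<exists>e. coset_model e E8_verts (Gw_compl_adj w)"
proof -
  \<comment> \<open>\<open>C\<close> carries the representative of an orbit to the line selected by
    \<open>w\<close>.\<close>
  have "\<exists>C. line (oct_act C r) = {w (L_orbit (line r)), - w (L_orbit (line r))}" if "r \<in> reps" for r
  proof -
    have "line (oct_act 0 r) \<in> E8_verts" 
      unfolding E8_verts_eq using that by (intro image_eqI[of _ _ "(0, r)"]) auto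
    then have "L_orbit (line r) \<in> L_orbits" by (simp add: L_orbits_def)
    then have "{w (L_orbit (line r)), - w (L_orbit (line r))} \<in> L_orbit (line r)"
      using w unfolding admissible_w_def by blast
    moreover have "\<exists>C. line (oct_act C r) = x" if "x \<in> L_orbit (line r)" for x
      using that by (auto simp: L_orbit_line)
    ultimately show ?thesis by blast
  qed
  then obtain C where C: "\<And>r. r \<in> reps \<Longrightarrow> line (oct_act (C r) r) = {w (L_orbit (line r)), - w (L_orbit (line r))}"
    by metis
  define e where "e = (\<lambda>(M, r). line (oct_act (M + C r) r))"
  have orbit: "L_orbit (e (M, r)) = L_orbit (line r)" for M r
    by (simp add: e_def L_orbit_line_act)
  have inner_w: "inner8 (w (L_orbit (line r))) (w (L_orbit (line r'))) = 0 \<longleftrightarrow>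
      oct_inner r (oct_act (C r + C r') r') = 0" if "r \<in> reps" "r' \<in> reps" for r r'
  proof -
    have "w (L_orbit (line s)) \<in> {vec_of (oct_act (C s) s), vec_of (- oct_act (C s) s)}" if "s \<in> reps" for s
      using C[OF that] unfolding vec_of_uminus line_def by blast
    from this[OF that(1)] this[OF that(2)] show ?thesis
      by (auto simp: inner8_vec_of oct_inner_act_eq_0_iff)
  qed
  have adj: "E8_adj (e (M, r)) (e (N, r')) \<longleftrightarrow> oct_inner r (oct_act (M + N + (C r + C r')) r') = 0" for M N r r'
    by (simp add: e_def E8_adj_line oct_inner_act_eq_0_iff add_ac)
  have e_eq: "e (M, r) = e (N, r') \<longleftrightarrow> r = r' \<and> M + N \<in> stab r" if "r \<in> reps" "r' \<in> reps" for M N r r'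
  proof (cases "r = r'")
    case True
    have "M + C r + (N + C r) = M + N + (C r + C r)" by (simp only: add_ac)
    then have "M + C r + (N + C r) = M + N" by (simp only: pauli3_add_self add_0_right)
    then show ?thesis unfolding True[symmetric] e_def by (simp only: prod.case line_act_same_rep simp_thms)
  qed (use that line_act_distinct_reps in \<open>simp add: e_def\<close>)
  show ?thesis
    unfolding coset_model_def
  proof (intro exI[of _ e] conjI allI ballI)
    have "(\<lambda>(M, r). (M + C r, r)) ` (UNIV \<times> reps) = UNIV \<times> reps"
    proof (intro equalityI subsetI)
      fix p assume "p \<in> (UNIV :: pauli3 set) \<times> reps"
      then show "p \<in> (\<lambda>(M, r). (M + C r, r)) ` (UNIV \<times> reps)"
        by (intro image_eqI[of _ _ "(fst p - C (snd p), snd p)"]) auto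
    qed auto
    then have "E8_verts = (\<lambda>(M, r). line (oct_act M r)) ` (\<lambda>(M, r). (M + C r, r)) ` (UNIV \<times> reps)"
      by (simp add: E8_verts_eq)
    also have "\<dots> = e ` (UNIV \<times> reps)" by (simp add: image_image e_def case_prod_beta)
    finally show "E8_verts = e ` (UNIV \<times> reps)" .
    show "e (M, r) = e (N, r') \<longleftrightarrow> r = r' \<and> M + N \<in> stab r" if "r \<in> reps" "r' \<in> reps" for M N r r'
      using that by (rule e_eq)
    show "Gw_compl_adj w (e (M, r)) (e (N, r')) \<longleftrightarrow> r \<noteq> r' \<and> M + N \<in> sum_stab r r'"
      if r: "r \<in> reps" "r' \<in> reps" for M N r r'
    proof (cases "r = r'")
      case True
      \<comment> \<open>Within an orbit nothing is switched, since a root is not orthogonal to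
        itself, and distinct lines are orthogonal; the complement has no edge there.\<close>
      then show ?thesis
        using r inner_self_nonzero[OF r(1)] inner_act_eq_0_iff[OF r(1)]
        by (auto simp: Gw_compl_adj_def Gw_adj_def e_eq orbit inner_w adj)
    next
      case False
      \<comment> \<open>The two orthogonality tests differ by the translation \<open>M + N\<close>,
        because the shift \<open>C r + C r'\<close> occurs in both and cancels.\<close>
      have "M + N + (C r + C r') + (C r + C r') = M + N + ((C r + C r') + (C r + C r'))"
        by (simp only: add_ac)
      then have "(oct_inner r (oct_act (M + N + (C r + C r')) r') = 0 \<longleftrightarrow>
          oct_inner r (oct_act (C r + C r') r') = 0) \<longleftrightarrow> M + N \<in> sum_stab r r'"
        by (simp only: orthogonality_toggle[OF r False] pauli3_add_self add_0_right)
      then show ?thesis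
        using False r by (auto simp: Gw_compl_adj_def Gw_adj_def e_eq orbit inner_w adj)
    qed
  qed
qed

section \<open>The folded halved 8-cube\<close>

definition pauli_set :: "nat set \<Rightarrow> nat set \<Rightarrow> pauli \<Rightarrow> nat set" where
  "pauli_set A B M = (case M of PI \<Rightarrow> {} | PX \<Rightarrow> A | PY \<Rightarrow> symdiff A B | PZ \<Rightarrow> B)"

text \<open>The six 4-sets are a hyperbolic basis of the even-weight vectors modulo the all-ones vector,
  where the quadratic form is half the weight modulo 2. So \<open>code_set\<close> induces an isometry from
  \<^typ>\<open>pauli3\<close> onto the vertices of the folded halved 8-cube.\<close>

definition code_set :: "pauli3 \<Rightarrow> nat set" where
  "code_set = (\<lambda>(a, b, c). symdiff (pauli_set {0, 1, 2, 3} {0, 1, 2, 4} a)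
     (symdiff (pauli_set {0, 3, 4, 5} {0, 3, 4, 6} b) (pauli_set {0, 1, 5, 6} {0, 2, 5, 6} c)))"

text \<open>The weight modulo 4 encodes the quadratic form; the last conjunct is injectivity modulo
  the all-ones vector.\<close>

lemma code_set_check:
  "\<forall>M\<in>set pauli3s. (\<forall>k\<in>code_set M. k < 8) \<and>
     card (code_set M) mod 4 = (if nonsingular M then 2 else 0) \<and>
     (code_set M = {} \<or> card (code_set M) = 8 \<longrightarrow> M = 0)"
  by code_simp

text \<open>Pairs containing 0 generate all even-weight vectors, so this yields surjectivity onto
  the folded vertices.\<close>

lemma pair_check:
  "\<forall>j\<in>set [1..<8].
     \<exists>M\<in>set pauli3s. code_set M = {0, j} \<or> symdiff (set [0..<8]) (code_set M) = {0, j}"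
  by code_simp

lemma opposite_spaces_check:
  "\<forall>W\<in>set opposite_spaces. distinct W \<and> length W = 8 \<and> (\<forall>M\<in>set W. \<not> nonsingular M)"
  by code_simp

section \<open>The isometry onto the folded halved 8-cube\<close>

lemma symdiff_commute: "symdiff A B = symdiff B A"
  by (auto simp: symdiff_def)

lemma symdiff_assoc: "symdiff (symdiff A B) C = symdiff A (symdiff B C)"
  by (auto simp: symdiff_def)

lemma symdiff_left_commute: "symdiff A (symdiff B C) = symdiff B (symdiff A C)"
  by (auto simp: symdiff_def)

lemmas symdiff_ac = symdiff_assoc symdiff_commute symdiff_left_commute

lemma symdiff_self [simp]: "symdiff A A = {}" "symdiff A (symdiff A B) = B"
  by (auto simp: symdiff_def)

lemma symdiff_empty [simp]: "symdiff A {} = A" "symdiff {} A = A"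
  by (auto simp: symdiff_def)

lemma code_set_add: "code_set (M + N) = symdiff (code_set M) (code_set N)"
proof -
  have *: "pauli_set A B (a + b) = symdiff (pauli_set A B a) (pauli_set A B b)" for A B a b
    by (cases a; cases b) (simp_all add: pauli_set_def plus_pauli_def zero_pauli_def symdiff_ac)
  show ?thesis by (cases M; cases N) (simp add: code_set_def * symdiff_ac)
qed

lemma code_set_0 [simp]: "code_set 0 = {}"
  using code_set_add[of 0 0] by simp

lemma code_set_subset: "code_set M \<subseteq> {..<8}"
  and card_code_set_mod: "card (code_set M) mod 4 = (if nonsingular M then 2 else 0)"
  and code_set_trivial: "code_set M = {} \<or> card (code_set M) = 8 \<Longrightarrow> M = 0"
  using code_set_check mem_pauli3s[of M] by blast+

lemma even_code_set: "even_vec (code_set M)"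
proof -
  have "card (code_set M) mod 4 mod 2 = 0" by (simp add: card_code_set_mod)
  then have "even (card (code_set M))" by (simp add: mod_mod_cancel even_iff_mod_2_eq_zero)
  then show ?thesis by (simp add: even_vec_def code_set_subset)
qed

definition fold_pair :: "nat set \<Rightarrow> nat set set" where
  "fold_pair x = {x, symdiff all_ones x}"

abbreviation fh :: "pauli3 \<Rightarrow> nat set set" where
  "fh M \<equiv> fold_pair (code_set M)"

lemma fold_pair_eq_iff: "fold_pair x = fold_pair y \<longleftrightarrow> x = y \<or> x = symdiff all_ones y"
  by (auto simp: fold_pair_def doubleton_eq_iff)

lemma fold_pair_symdiff_cong: "fold_pair x = fold_pair y \<Longrightarrow> fold_pair (symdiff z x) = fold_pair (symdiff z y)"
  by (auto simp: fold_pair_eq_iff symdiff_ac)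

lemma fh_add: "fold_pair x = fh M \<Longrightarrow> fold_pair y = fh N \<Longrightarrow> fold_pair (symdiff x y) = fh (M + N)"
  by (metis code_set_add fold_pair_symdiff_cong symdiff_commute)

lemma card_symdiff_all_ones:
  assumes "x \<subseteq> {..<8}"
  shows "card (symdiff all_ones x) = 8 - card x"
proof -
  have "symdiff all_ones x = {..<8} - x" using assms by (auto simp: symdiff_def all_ones_def)
  then show ?thesis using assms by (simp add: card_Diff_subset finite_subset)
qed

lemma fh_eq_iff [simp]: "fh M = fh N \<longleftrightarrow> M = N"
proof
  assume "fh M = fh N"
  then have "fh (M + N) = fh (N + N)"
    using fh_add[of "code_set M" N "code_set N" N] by (simp add: code_set_add)
  then have "code_set (M + N) = {} \<or> code_set (M + N) = all_ones"
    by (auto simp: fold_pair_eq_iff)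
  then have "code_set (M + N) = {} \<or> card (code_set (M + N)) = 8"
    by (metis all_ones_def card_lessThan)
  then have "M + N = 0" by (rule code_set_trivial)
  then show "M = N" by simp
qed simp

lemma inj_fh: "inj fh"
  by (simp add: inj_def)

lemma pair_fh:
  assumes "i < 8" "j < 8" "i \<noteq> j"
  shows "\<exists>t. fold_pair {i, j} = fh t"
proof -
  have 0: "\<exists>t. fold_pair {0, k} = fh t" if "k < 8" "k \<noteq> 0" for k
  proof -
    have "set [0..<8] = all_ones" by (auto simp: all_ones_def)
    moreover have "k \<in> set [1..<8]" using that by auto
    ultimately obtain M where "code_set M = {0, k} \<or> symdiff all_ones (code_set M) = {0, k}"
      using pair_check by metis
    then have "fold_pair {0, k} = fh M" by (auto simp: fold_pair_eq_iff)
    then show ?thesis by blast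
  qed
  show ?thesis
  proof (cases "i = 0 \<or> j = 0")
    case True
    then show ?thesis using 0 assms by (metis insert_commute)
  next
    case False
    then have "{i, j} = symdiff {0, i} {0, j}" using assms by (auto simp: symdiff_def)
    then show ?thesis using 0[of i] 0[of j] False assms fh_add by metis
  qed
qed

lemma even_vec_fh: "even_vec x \<Longrightarrow> \<exists>M. fold_pair x = fh M"
proof (induction "card x" arbitrary: x rule: less_induct)
  case less
  have fin: "finite x" using less.prems finite_subset by (auto simp: even_vec_def)
  show ?case
  proof (cases "x = {}")
    case True
    then show ?thesis by (metis code_set_0)
  next
    case False
    then obtain i where i: "i \<in> x" by blast
    have "x \<noteq> {i}" using less.prems by (auto simp: even_vec_def)
    then obtain j where j: "j \<in> x" "j \<noteq> i" using i by blast
    have card: "card x = card (x - {i, j}) + 2"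
      using i j fin card_Diff_subset[of "{i, j}" x] card_mono[of x "{i, j}"] by simp
    have ij: "i < 8" "j < 8" using i j less.prems by (auto simp: even_vec_def)
    have "even_vec (x - {i, j})" using less.prems card by (auto simp: even_vec_def)
    then obtain M where M: "fold_pair (x - {i, j}) = fh M" using less.hyps card by fastforce
    obtain t where t: "fold_pair {i, j} = fh t" using pair_fh ij j(2) by metis
    have "x = symdiff (x - {i, j}) {i, j}" using i j by (auto simp: symdiff_def)
    then show ?thesis using fh_add[OF M t] by metis
  qed
qed

lemma FH_verts_eq: "FH_verts = range fh"
  unfolding FH_verts_def fold_pair_def[symmetric] using even_vec_fh even_code_set by blast

lemma mod_4_le_8:
  fixes n :: nat
  assumes "n \<le> 8"
  shows "n mod 4 = 0 \<longleftrightarrow> n = 0 \<or> n = 4 \<or> n = 8" "n mod 4 = 2 \<longleftrightarrow> n = 2 \<or> n = 6"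
  using assms by presburger+

text \<open>Complementing replaces an even weight w by 8 - w, which is congruent to w modulo 4, so
  either member of a folded pair computes the form.\<close>

lemma card_symdiff_fh:
  assumes "fold_pair x = fh M"
  shows "card x mod 4 = (if nonsingular M then 2 else 0)" "x \<subseteq> {..<8}" "card x \<le> 8"
proof -
  have le: "card (code_set M) \<le> 8" using card_mono[OF _ code_set_subset[of M]] by simp
  have x: "x = code_set M \<or> x = symdiff all_ones (code_set M)" using assms by (simp add: fold_pair_eq_iff)
  then show "x \<subseteq> {..<8}" using code_set_subset[of M] by (auto simp: symdiff_def all_ones_def)
  show "card x \<le> 8" using x le card_symdiff_all_ones[OF code_set_subset[of M]] by auto
  show "card x mod 4 = (if nonsingular M then 2 else 0)"
    using x
  proof
    assume "x = symdiff all_ones (code_set M)"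
    then have "card x = 8 - card (code_set M)" by (simp add: card_symdiff_all_ones code_set_subset)
    then have "card x mod 4 = (8 - card (code_set M)) mod 4" by simp
    also have "\<dots> = (if nonsingular M then 2 else 0)"
      using card_code_set_mod[of M] by (cases "nonsingular M") (auto simp: mod_4_le_8[OF le])
    finally show ?thesis .
  qed (simp add: card_code_set_mod)
qed

text \<open>A weight of at most 8 is 2 modulo 4 exactly when it or its complementary weight is
  2.\<close>

lemma FH_adj_fh: "FH_adj (fh M) (fh N) \<longleftrightarrow> nonsingular (M + N)"
proof -
  have *: "(card (symdiff x y) = 2 \<or> card (symdiff (symdiff x y) all_ones) = 2) \<longleftrightarrow> nonsingular (M + N)"
    if "fold_pair x = fh M" "fold_pair y = fh N" for x y
  proof -
    note f = card_symdiff_fh[OF fh_add[OF that]]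
    have "card (symdiff (symdiff x y) all_ones) = 8 - card (symdiff x y)"
      using card_symdiff_all_ones[OF f(2)] by (simp add: symdiff_commute)
    then show ?thesis using f(1)
      by (cases "nonsingular (M + N)") (auto simp: mod_4_le_8[OF f(3)])
  qed
  show ?thesis unfolding FH_adj_def fold_pair_def[symmetric] using * by metis
qed

section \<open>Translations and coordinate permutations\<close>

lemma image_symdiff: "inj p \<Longrightarrow> p ` symdiff x y = symdiff (p ` x) (p ` y)"
  by (auto simp: symdiff_def inj_def)

lemma FH_act_fold_pair:
  assumes "p permutes {..<8}"
  shows "FH_act a p (fold_pair x) = fold_pair (symdiff (p ` x) a)"
proof -
  have "p ` all_ones = all_ones" using assms by (simp add: all_ones_def permutes_image)
  then show ?thesis
    using image_symdiff[OF permutes_inj[OF assms]]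
    by (simp add: FH_act_def fold_pair_def symdiff_assoc)
qed

lemma even_vec_image: "p permutes {..<8} \<Longrightarrow> even_vec x \<Longrightarrow> even_vec (p ` x)"
  unfolding even_vec_def
  by (metis card_image image_mono inj_on_subset permutes_image permutes_inj subset_UNIV)

lemma even_vec_symdiff: "even_vec x \<Longrightarrow> even_vec y \<Longrightarrow> even_vec (symdiff x y)"
proof -
  assume "even_vec x" "even_vec y"
  then obtain M N where "fold_pair x = fh M" "fold_pair y = fh N" using even_vec_fh by metis
  note f = card_symdiff_fh[OF fh_add[OF this]]
  have "card (symdiff x y) mod 4 mod 2 = 0" by (simp add: f(1))
  then show ?thesis using f(2) by (simp add: even_vec_def mod_mod_cancel even_iff_mod_2_eq_zero)
qed

text \<open>The transposition of coordinates \<open>i\<close> and \<open>j\<close> is the transvection along \<open>{i, j}\<close>, a nonsingular vector.\<close>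

lemma transpose_fh:
  assumes ij: "i < 8" "j < 8" "i \<noteq> j"
  obtains t where "nonsingular t"
    "\<And>M. \<not> nonsingular M \<Longrightarrow> FH_act {} (Transposition.transpose i j) (fh M) = fh (transvection t M)"
proof -
  obtain t where t: "fold_pair {i, j} = fh t" using pair_fh[OF ij] by blast
  have "nonsingular t" using card_symdiff_fh(1)[OF t] ij by (auto split: if_splits)
  moreover have "FH_act {} (Transposition.transpose i j) (fh M) = fh (transvection t M)"
    if M: "\<not> nonsingular M" for M
  proof -
    let ?x = "code_set M"
    have act: "FH_act {} (Transposition.transpose i j) (fh M) = fold_pair (Transposition.transpose i j ` ?x)"
      using ij by (simp add: FH_act_fold_pair permutes_swap_id)
    have sum: "fold_pair (symdiff ?x {i, j}) = fh (M + t)" using fh_add[OF refl t] .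
    note f = card_symdiff_fh(1)[OF sum] card_code_set_mod[of M]
    have fin: "finite ?x" using code_set_subset finite_subset by blast
    show ?thesis
    \<comment> \<open>If the swap fixes the set, adding the pair changes the weight by 2; otherwise
      adding the pair is the swap and keeps the weight.\<close>
    proof (cases "i \<in> ?x \<longleftrightarrow> j \<in> ?x")
      case True
      have "card (symdiff ?x {i, j}) = card ?x + 2 \<or> card ?x = card (symdiff ?x {i, j}) + 2"
      proof (cases "i \<in> ?x")
        case i: True
        have "symdiff ?x {i, j} = ?x - {i, j}" using True i by (auto simp: symdiff_def)
        moreover have "card ?x = card (?x - {i, j}) + 2"
          using True i fin ij(3) card_Diff_subset[of "{i, j}" ?x] card_mono[of ?x "{i, j}"] by simp
        ultimately show ?thesis by simp
      next
        case i: False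
        have "symdiff ?x {i, j} = insert i (insert j ?x)" using True i by (auto simp: symdiff_def)
        then show ?thesis using True i fin ij(3) by simp
      qed
      moreover have "card ?x mod 4 = 0" using f(2) M by simp
      ultimately have "card (symdiff ?x {i, j}) mod 4 \<noteq> 0" by presburger
      then have "nonsingular (M + t)" using f(1) by (simp split: if_splits)
      moreover have "Transposition.transpose i j ` ?x = ?x"
        using True by (auto simp: Transposition.transpose_def image_iff split: if_splits)
      ultimately show ?thesis by (simp add: act transvection_def)
    next
      case False
      have *: "Transposition.transpose i j ` ?x = symdiff ?x {i, j}"
        using False ij(3) by (auto simp: Transposition.transpose_def symdiff_def image_iff split: if_splits)
      then have "card (symdiff ?x {i, j}) = card ?x"
        by (metis card_image inj_on_subset inj_transpose subset_UNIV)
      then have "\<not> nonsingular (M + t)" using f M by (simp split: if_splits)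
      then show ?thesis by (simp add: act transvection_def * sum)
    qed
  qed
  ultimately show ?thesis by (rule that)
qed

definition family :: "bool \<Rightarrow> pauli3 set set" where
  "family b = (if b then stab ` reps else set ` set opposite_spaces)"

lemma family_properties:
  assumes "U \<in> family b"
  shows family_card: "card U = 8" and family_singular: "M \<in> U \<Longrightarrow> \<not> nonsingular M"
    and family_finite: "finite U"
proof -
  have "card U = 8 \<and> (\<forall>M\<in>U. \<not> nonsingular M)"
  proof (cases b)
    case True
    then show ?thesis using assms card_stab stab_singular by (auto simp: family_def)
  next
    case False
    then obtain W where "W \<in> set opposite_spaces" "U = set W" using assms by (auto simp: family_def)
    then show ?thesis using opposite_spaces_check by (metis distinct_card)
  qed
  then show "card U = 8" "M \<in> U \<Longrightarrow> \<not> nonsingular M" by blast+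
  show "finite U" using \<open>card U = 8\<close> card.infinite by fastforce
qed

lemma transvection_family:
  assumes "nonsingular t" "U \<in> family b"
  obtains U' where "U' \<in> family (\<not> b)" "transvection t ` U \<subseteq> U'"
proof (cases b)
  case True
  then obtain r W where rW: "(r, W) \<in> set frames" "U = set W"
    using assms(2) by (auto simp: family_def elim!: reps_frame)
  have "\<forall>(r, W)\<in>set frames. \<exists>W'\<in>set opposite_spaces. \<forall>M\<in>set W. transvection t M \<in> set W'"
    using transvection_swaps assms(1) mem_pauli3s by blast
  from bspec[OF this rW(1)] obtain W' where "W' \<in> set opposite_spaces" "\<forall>M\<in>set W. transvection t M \<in> set W'"
    unfolding prod.case by blast
  then show ?thesis using that[of "set W'"] rW True by (auto simp: family_def)
next
  case False
  then obtain W' where W': "W' \<in> set opposite_spaces" "U = set W'"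
    using assms(2) by (auto simp: family_def)
  have "\<forall>W'\<in>set opposite_spaces. \<exists>(r, W)\<in>set frames. \<forall>M\<in>set W'. transvection t M \<in> set W"
    using transvection_swaps assms(1) mem_pauli3s by blast
  from bspec[OF this W'(1)] obtain r W where rW: "(r, W) \<in> set frames" "\<forall>M\<in>set W'. transvection t M \<in> set W"
    by blast
  have "r \<in> reps" unfolding reps_def using imageI[OF rW(1), of fst] by simp
  then have "set W \<in> family True" by (simp add: family_def set_frame[OF rW(1)])
  then show ?thesis using that[of "set W"] rW(2) W' False by auto
qed

lemma FH_act_comp: "FH_act {} (q \<circ> p) = FH_act {} q \<circ> FH_act {} p"
  by (auto simp: FH_act_def image_comp fun_eq_iff)

lemma inj_FH_act: "inj p \<Longrightarrow> inj (FH_act {} p)"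
  unfolding FH_act_def by (auto simp: inj_def inj_image_eq_iff)

text \<open>Each transposition negates the family index, so the index records the parity of
  \<open>p\<close>.\<close>

lemma permutation_family:
  assumes "p permutes {..<8}" "U \<in> family b"
  shows "\<exists>U'\<in>family (b = evenperm p). FH_act {} p ` fh ` U = fh ` U'"
  using assms(1) finite_lessThan
proof (induction p rule: permutes_induct)
  case id
  have "FH_act {} id = id" by (auto simp: FH_act_def fun_eq_iff)
  then have "FH_act {} id ` fh ` U = fh ` U" by (simp only: image_id id_apply)
  then show ?case using assms(2) by (intro bexI[of _ U]) (simp_all only: evenperm_id simp_thms)
next
  case (swap i j p)
  then obtain U' where U': "U' \<in> family (b = evenperm p)" "FH_act {} p ` fh ` U = fh ` U'" by blast
  obtain t where t: "nonsingular t"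
    "\<And>M. \<not> nonsingular M \<Longrightarrow> FH_act {} (Transposition.transpose i j) (fh M) = fh (transvection t M)"
    using transpose_fh swap.hyps by (metis lessThan_iff)
  obtain U'' where U'': "U'' \<in> family (\<not> (b = evenperm p))" "transvection t ` U' \<subseteq> U''"
    using transvection_family[OF t(1) U'(1)] .
  have eq: "FH_act {} (Transposition.transpose i j) ` fh ` U' = fh ` transvection t ` U'"
    unfolding image_image using t(2) family_singular[OF U'(1)] by (intro image_cong) auto
  \<comment> \<open>The coordinate action is injective, so the image still has 8 elements and fills
    the space that contains it.\<close>
  have "card (fh ` transvection t ` U') = card (fh ` U')"
    unfolding eq[symmetric] by (intro card_image inj_on_subset[OF inj_FH_act]) auto
  then have "card (transvection t ` U') = 8"
    using family_card[OF U'(1)] by (simp add: card_image inj_on_subset[OF inj_fh])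
  then have "transvection t ` U' = U''"
    using U'' family_card[OF U''(1)] family_finite[OF U''(1)] card_subset_eq by metis
  then have "FH_act {} (Transposition.transpose i j \<circ> p) ` fh ` U = fh ` U''"
    using U'(2) eq by (simp only: FH_act_comp image_comp[symmetric])
  moreover have "(b = evenperm (Transposition.transpose i j \<circ> p)) = (\<not> (b = evenperm p))"
    using swap.hyps by (simp add: evenperm_comp evenperm_swap permutation_swap_id permutes_imp_permutation[of "{..<8}"])
  ultimately show ?case using U''(1) by (intro bexI[of _ U'']) (simp_all only:)
qed

definition coset :: "pauli3 \<Rightarrow> pauli3 set \<Rightarrow> nat set set set" where
  "coset N U = (\<lambda>M. fh (N + M)) ` U"

text \<open>The group acts by affine maps: the permutation moves the direction space, and the image
  of the base point together with the translation gives \<open>K\<close>.\<close>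

lemma FH_act_coset:
  assumes "FH_act {} p ` fh ` U = fh ` U'" "p permutes {..<8}" "even_vec a"
  shows "\<exists>K. FH_act a p ` coset N U = coset K U'"
proof -
  have "even_vec (symdiff (p ` code_set N) a)"
    using assms(2,3) by (intro even_vec_symdiff even_vec_image even_code_set)
  then obtain K where K: "fold_pair (symdiff (p ` code_set N) a) = fh K" using even_vec_fh by blast
  have 1: "FH_act a p (fh (N + M)) = FH_act (code_set K) id (FH_act {} p (fh M))" for M
  proof -
    have "FH_act a p (fh (N + M)) = fold_pair (symdiff (p ` code_set M) (symdiff (p ` code_set N) a))"
      by (simp add: FH_act_fold_pair[OF assms(2)] code_set_add image_symdiff[OF permutes_inj[OF assms(2)]] symdiff_ac)
    also have "\<dots> = fold_pair (symdiff (p ` code_set M) (code_set K))"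
      using K by (rule fold_pair_symdiff_cong)
    finally show ?thesis by (simp add: FH_act_fold_pair[OF assms(2)] FH_act_fold_pair[OF permutes_id])
  qed
  have 2: "FH_act (code_set K) id (fh M) = fh (K + M)" for M
    by (simp add: FH_act_fold_pair[OF permutes_id] code_set_add symdiff_commute)
  have "FH_act a p ` coset N U = FH_act (code_set K) id ` (FH_act {} p ` fh ` U)"
    by (simp add: coset_def image_image 1)
  also have "\<dots> = coset K U'" unfolding assms(1) by (simp add: coset_def image_image 2)
  finally show ?thesis by blast
qed

lemma coset_FH_act:
  assumes "U \<in> family b" "p permutes {..<8}" "even_vec a"
  obtains K U' where "U' \<in> family (b = evenperm p)" "FH_act a p ` coset N U = coset K U'"
  using permutation_family[OF assms(2,1)] FH_act_coset[OF _ assms(2,3)] by metis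

section \<open>Cosets as independent sets\<close>

lemma FH_indep8_coset:
  assumes "FH_indep8 S"
  obtains N b U where "U \<in> family b" "S = coset N U"
proof -
  define A where "A = fh -` S"
  have S: "S \<subseteq> range fh" "card S = 8" "\<forall>P\<in>S. \<forall>Q\<in>S. \<not> FH_adj P Q"
    using assms by (auto simp: FH_indep8_def FH_verts_eq)
  have SA: "S = fh ` A" unfolding A_def using S(1) by blast
  have cardA: "card A = 8" using S(2) unfolding SA by (simp add: card_image inj_on_subset[OF inj_fh])
  then have "A \<noteq> {}" by auto
  then obtain N where N: "N \<in> A" by blast
  \<comment> \<open>Translating by a member puts 0 into the set, so that every element of
    \<open>B\<close> and every pairwise sum is singular.\<close>
  define B where "B = (+) N ` A"
  have cardB: "card B = 8" unfolding B_def using cardA by (simp add: card_image)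
  then have finB: "finite B" using card.infinite by fastforce
  have 0: "0 \<in> B" unfolding B_def using imageI[OF N, of "(+) N"] by simp
  have pair: "\<not> nonsingular (x + y)" if xy: "x \<in> B" "y \<in> B" for x y
  proof -
    obtain M M' where M: "M \<in> A" "M' \<in> A" "x = N + M" "y = N + M'" using xy by (auto simp: B_def)
    have "x + y = M + M'" unfolding M by (rule pauli3_add_add_cancel)
    moreover have "\<not> FH_adj (fh M) (fh M')" using S(3) M(1,2) unfolding SA by blast
    ultimately show ?thesis by (simp only: FH_adj_fh not_False_eq_True)
  qed
  have sing: "\<not> nonsingular x" if "x \<in> B" for x using pair[OF that 0] by simp
  \<comment> \<open>Eight elements do not fit into a shorter list, so \<open>a\<close>,
    \<open>b\<close>, \<open>c\<close> can be picked in turn outside the span of the earlier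
    ones.\<close>
  have fresh: "\<exists>a\<in>B. a \<notin> set X" if "length X < 8" for X
  proof (rule ccontr)
    assume "\<not> (\<exists>a\<in>B. a \<notin> set X)"
    then have "card B \<le> card (set X)" by (intro card_mono) auto
    then show False using cardB that card_length[of X] by linarith
  qed
  obtain a where a: "a \<in> B" "a \<noteq> 0" using fresh[of "[0]"] by auto
  obtain b where b: "b \<in> B" "b \<notin> set [0, a]" using fresh[of "[0, a]"] by auto
  obtain c where c: "c \<in> B" "c \<notin> set [0, a, b, a + b]" using fresh[of "[0, a, b, a + b]"] by auto
  have "a \<in> set (filter (\<lambda>a. \<not> nonsingular a) pauli3s)" using sing[OF a(1)] by simp
  note c1 = mp[OF bspec[OF classification_check[unfolded Let_def] this] a(2)]
  have "b \<in> set (filter (\<lambda>x. \<not> nonsingular (x + a)) (filter (\<lambda>a. \<not> nonsingular a) pauli3s))"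
    using sing[OF b(1)] pair[OF b(1) a(1)] by simp
  note c2 = mp[OF bspec[OF c1 this] b(2)]
  have "c \<in> set (filter (\<lambda>x. \<not> nonsingular (x + b))
      (filter (\<lambda>x. \<not> nonsingular (x + a)) (filter (\<lambda>a. \<not> nonsingular a) pauli3s)))"
    using sing[OF c(1)] pair[OF c(1) a(1)] pair[OF c(1) b(1)] by simp
  note c3 = mp[OF bspec[OF c2 this] c(2)]
  from c3 obtain W where W: "W \<in> set (map snd frames @ opposite_spaces)"
    and W_max: "\<forall>x\<in>set (filter (\<lambda>x. \<not> nonsingular (x + b))
      (filter (\<lambda>x. \<not> nonsingular (x + a)) (filter (\<lambda>a. \<not> nonsingular a) pauli3s))).
        \<not> nonsingular (x + c) \<longrightarrow> x \<in> set W"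
    unfolding set_filter by blast
  have sub: "B \<subseteq> set W"
  proof
    fix x assume x: "x \<in> B"
    have "x \<in> set (filter (\<lambda>x. \<not> nonsingular (x + b))
      (filter (\<lambda>x. \<not> nonsingular (x + a)) (filter (\<lambda>a. \<not> nonsingular a) pauli3s)))"
      using sing[OF x] pair[OF x a(1)] pair[OF x b(1)] by simp
    then show "x \<in> set W" using W_max pair[OF x c(1)] by blast
  qed
  have "\<exists>b. set W \<in> family b"
  proof (cases "W \<in> set opposite_spaces")
    case True
    then show ?thesis by (intro exI[of _ False]) (simp add: family_def)
  next
    case False
    then obtain r where r: "(r, W) \<in> set frames" using W by auto
    have "r \<in> reps" unfolding reps_def using imageI[OF r, of fst] by simp
    then show ?thesis by (intro exI[of _ True]) (simp add: family_def set_frame[OF r])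
  qed
  then obtain b' where W_fam: "set W \<in> family b'" by blast
  have "B = set W" using card_subset_eq[OF _ sub] cardB family_card[OF W_fam] by simp
  moreover have "S = coset N B"
    unfolding SA coset_def B_def image_image by simp
  ultimately show ?thesis using that W_fam by blast
qed

section \<open>Intersections of cosets\<close>

lemma coset_stab: "coset N (stab r) = fh ` {x. N + x \<in> stab r}"
proof -
  have "{x. N + x \<in> stab r} = (+) N ` stab r"
  proof (intro equalityI subsetI)
    fix x assume "x \<in> {x. N + x \<in> stab r}"
    then show "x \<in> (+) N ` stab r" by (intro image_eqI[of _ _ "N + x"]) simp_all
  qed auto
  then show ?thesis by (simp add: coset_def image_image)
qed

text \<open>A nonempty intersection is a translate of \<open>stab r \<inter> stab r'\<close>, and a
  common point amounts to splitting \<open>N + N'\<close> between the two stabilizers.\<close>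

lemma card_coset_Int:
  "card (coset N (stab r) \<inter> coset N' (stab r')) =
     (if N + N' \<in> sum_stab r r' then card (stab r \<inter> stab r') else 0)"
proof -
  define A where "A = {x. N + x \<in> stab r} \<inter> {x. N' + x \<in> stab r'}"
  have "card (coset N (stab r) \<inter> coset N' (stab r')) = card A"
    unfolding coset_stab image_Int[OF inj_fh, symmetric] A_def
    by (rule card_image) (rule inj_on_subset[OF inj_fh], simp)
  moreover have "card A = card (stab r \<inter> stab r')" if x0: "x0 \<in> A" for x0
  proof -
    have "A = (+) x0 ` (stab r \<inter> stab r')"
    proof (intro equalityI subsetI)
      fix x assume x: "x \<in> A"
      have "x0 + x \<in> stab r \<inter> stab r'"
        using x x0 stab_add[of "N + x0" r "N + x"] stab_add[of "N' + x0" r' "N' + x"]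
        by (simp add: A_def pauli3_add_add_cancel)
      then show "x \<in> (+) x0 ` (stab r \<inter> stab r')" by (intro image_eqI[of _ _ "x0 + x"]) simp_all
    next
      fix x assume "x \<in> (+) x0 ` (stab r \<inter> stab r')"
      then show "x \<in> A" using x0 by (auto simp: A_def add.assoc[symmetric] intro: stab_add)
    qed
    then show ?thesis by (simp add: card_image)
  qed
  moreover have "A \<noteq> {} \<longleftrightarrow> N + N' \<in> sum_stab r r'"
  proof
    assume "A \<noteq> {}"
    then obtain x where x: "N + x \<in> stab r" "N' + x \<in> stab r'" by (auto simp: A_def)
    then show "N + N' \<in> sum_stab r r'"
      unfolding sum_stab_def by (intro CollectI bexI[of _ "N + x"]) (simp_all add: pauli3_add_add_cancel)
  next
    assume "N + N' \<in> sum_stab r r'"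
    then obtain a where a: "a \<in> stab r" "N + N' + a \<in> stab r'" by (auto simp: sum_stab_def)
    have "N' + (N + a) \<in> stab r'" using a(2) by (simp only: add_ac)
    then have "N + a \<in> A" using a(1) by (simp add: A_def)
    then show "A \<noteq> {}" by blast
  qed
  ultimately show ?thesis by (metis all_not_in_conv card.empty)
qed

lemma sum_stab_self: "sum_stab r r = stab r"
proof (rule set_eqI)
  fix P
  have "a \<in> stab r \<Longrightarrow> P + a \<in> stab r \<longleftrightarrow> P \<in> stab r" for a
    using stab_add_iff[of a r P] by (simp only: add.commute)
  then show "P \<in> sum_stab r r \<longleftrightarrow> P \<in> stab r"
    unfolding sum_stab_def using zero_in_stab by blast
qed

lemma card_stab_Int:
  assumes "r \<in> reps" "r' \<in> reps" "r \<noteq> r'"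
  shows "card (stab r \<inter> stab r') = 2"
  using distinct_reps[OF assms] by (metis card_2_iff)

text \<open>Equal cosets meet in 8 points, whereas distinct stabilizers share only two
  elements.\<close>

lemma coset_eq_iff:
  assumes "r \<in> reps" "r' \<in> reps"
  shows "coset N (stab r) = coset N' (stab r') \<longleftrightarrow> r = r' \<and> N + N' \<in> stab r"
proof
  assume eq: "coset N (stab r) = coset N' (stab r')"
  have "card (coset N (stab r) \<inter> coset N' (stab r')) = 8"
    unfolding eq[symmetric] card_coset_Int using card_stab[OF assms(1)] by (simp add: sum_stab_self)
  then have *: "N + N' \<in> sum_stab r r'" "card (stab r \<inter> stab r') = 8"
    unfolding card_coset_Int by (simp_all split: if_splits)
  then have "r = r'" using card_stab_Int[OF assms] by fastforce
  then show "r = r' \<and> N + N' \<in> stab r" using *(1) by (simp add: sum_stab_self)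
next
  assume r: "r = r' \<and> N + N' \<in> stab r"
  have "N + x \<in> stab r \<longleftrightarrow> N' + x \<in> stab r" for x
    using stab_add_iff[of "N + N'" r "N' + x", OF conjunct2[OF r]] by (simp only: pauli3_add_add_cancel)
  then show "coset N (stab r) = coset N' (stab r')" using r by (simp add: coset_stab)
qed

lemma Gamma1_adj_coset:
  assumes "r \<in> reps" "r' \<in> reps"
  shows "Gamma1_adj (coset N (stab r)) (coset N' (stab r')) \<longleftrightarrow> r \<noteq> r' \<and> N + N' \<in> sum_stab r r'"
  unfolding Gamma1_adj_def card_coset_Int
  using card_stab_Int[OF assms] card_stab[OF assms(1)] by (cases "r = r'") auto

definition cosets :: "nat set set set set" where
  "cosets = (\<lambda>(N, r). coset N (stab r)) ` (UNIV \<times> reps)"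

lemma card_UNIV_pauli3: "finite (UNIV :: pauli3 set)" "card (UNIV :: pauli3 set) \<le> 64"
proof -
  have *: "(UNIV :: pauli3 set) = set pauli3s" using mem_pauli3s by blast
  show "finite (UNIV :: pauli3 set)" unfolding * by simp
  show "card (UNIV :: pauli3 set) \<le> 64"
    unfolding * using card_length[of pauli3s] by (simp add: pauli3s_def)
qed

text \<open>For each of at most 15 subspaces, disjoint cosets of size 8 inside at most 64 points
  number at most 8.\<close>

lemma finite_cosets: "finite cosets" and card_cosets: "card cosets \<le> 120"
proof -
  have eq: "cosets = (\<Union>r\<in>reps. range (\<lambda>N. coset N (stab r)))" by (auto simp: cosets_def)
  have reps: "finite reps" "card reps \<le> 15"
    unfolding reps_def using card_image_le[of "set frames" fst] card_length[of frames]
    by (simp_all add: frames_def)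
  then show "finite cosets" unfolding eq using card_UNIV_pauli3(1) by simp
  have "card (range (\<lambda>N. coset N (stab r))) \<le> 8" if r: "r \<in> reps" for r
  proof -
    let ?C = "range (\<lambda>N. coset N (stab r))"
    have fin: "finite ?C" using card_UNIV_pauli3(1) by simp
    have sub: "\<Union>?C \<subseteq> range fh" by (auto simp: coset_def)
    have "finite (range fh)" using card_UNIV_pauli3(1) by simp
    then have finU: "finite (\<Union>?C)" and le: "card (\<Union>?C) \<le> card (range fh)"
      using sub finite_subset card_mono by blast+
    have "card (coset N (stab r)) = 8" for N
      using card_coset_Int[of N r N r] card_stab[OF r] by (simp add: sum_stab_self)
    then have card8: "\<forall>c\<in>?C. card c = 8" by blast
    have "coset N (stab r) \<inter> coset N' (stab r) = {}" if "coset N (stab r) \<noteq> coset N' (stab r)" for N N'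
    proof -
      have "N + N' \<notin> stab r" using that coset_eq_iff[OF r r] by blast
      then have "card (coset N (stab r) \<inter> coset N' (stab r)) = 0" by (simp add: card_coset_Int sum_stab_self)
      moreover have "finite (coset N (stab r))"
        using card_UNIV_pauli3(1) by (auto simp: coset_def intro: finite_subset)
      ultimately show ?thesis by simp
    qed
    then have disj: "\<forall>c\<in>?C. \<forall>c'\<in>?C. c \<noteq> c' \<longrightarrow> c \<inter> c' = {}" by blast
    have "8 * card ?C = card (\<Union>?C)"
      using card8 disj by (intro card_partition[OF fin finU]) blast+
    also have "\<dots> \<le> 64"
      using le card_image_le[OF card_UNIV_pauli3(1), of fh] card_UNIV_pauli3(2) by linarith
    finally show ?thesis by simp
  qed
  then have "(\<Sum>r\<in>reps. card (range (\<lambda>N. coset N (stab r)))) \<le> (\<Sum>r\<in>reps. 8)" by (rule sum_mono)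
  then have "card cosets \<le> (\<Sum>r\<in>reps. 8)"
    unfolding eq by (rule order_trans[OF card_UN_le[OF reps(1)]])
  then show "card cosets \<le> 120" using reps(2) by simp
qed

lemma Gamma1_model:
  assumes "Gamma1_vertex_set Orb"
  shows "\<exists>h. coset_model h Orb Gamma1_adj"
proof -
  obtain S where S: "FH_indep8 S" "Orb = FH_orbit S" and card_Orb: "card Orb = 120"
    using assms by (auto simp: Gamma1_vertex_set_def)
  obtain N0 b U where U: "U \<in> family b" "S = coset N0 U" using FH_indep8_coset[OF S(1)] .
  \<comment> \<open>If the orbit belongs to the opposite family, one transposition carries it to the
    family of stabilizers; in both cases \<open>q\<close> is an involution.\<close>
  define q :: "nat \<Rightarrow> nat" where "q = (if b then id else Transposition.transpose 0 1)"
  have q: "q permutes {..<8}" "evenperm q = b" "q \<circ> q = id"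
    unfolding q_def by (auto simp: permutes_id permutes_swap_id evenperm_swap)
  define f where "f = image (FH_act {} q)"
  have inj_q: "inj (FH_act {} q)" by (rule inj_FH_act[OF permutes_inj[OF q(1)]])
  have "FH_act {} q \<circ> FH_act {} q = id"
    unfolding FH_act_comp[symmetric] q(3) by (auto simp: FH_act_def fun_eq_iff)
  then have ff: "f (f T) = T" for T unfolding f_def image_comp by simp
  have "f T \<in> cosets" if T: "T \<in> Orb" for T
  proof -
    obtain a p where ap: "even_vec a" "p permutes {..<8}" "evenperm p" "T = FH_act a p ` S"
      using T S(2) by (auto simp: FH_orbit_def FH_group_elt_def)
    obtain K U' where K: "U' \<in> family (b = evenperm p)" "T = coset K U'"
      using coset_FH_act[OF U(1) ap(2,1), of N0] ap(4) U(2) by metis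
    have "even_vec {}" by (simp add: even_vec_def)
    from coset_FH_act[OF K(1) q(1) this, of K]
    obtain K' U'' where "U'' \<in> family ((b = evenperm p) = evenperm q)" "f T = coset K' U''"
      unfolding K(2) f_def by metis
    moreover from this(1) obtain r where "r \<in> reps" "U'' = stab r"
      using ap(3) q(2) by (auto simp: family_def)
    ultimately show ?thesis unfolding cosets_def by (intro image_eqI[of _ _ "(K', r)"]) simp_all
  qed
  then have sub: "f ` Orb \<subseteq> cosets" by blast
  \<comment> \<open>An injective image of 120 elements inside a set of at most 120 is the whole
    set.\<close>
  have "inj f" using ff by (metis injI)
  then have "card (f ` Orb) = 120" using card_Orb by (simp add: card_image inj_on_subset[of f UNIV])
  then have "f ` Orb = cosets"
    using sub card_cosets finite_cosets card_mono[OF finite_cosets sub] by (intro card_subset_eq) auto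
  then have "Orb = f ` cosets" using image_image[of f f Orb] by (simp add: ff)
  then have "Orb = (\<lambda>(N, r). f (coset N (stab r))) ` (UNIV \<times> reps)"
    unfolding cosets_def image_image by (simp add: case_prod_beta)
  moreover have "f S = f T \<longleftrightarrow> S = T" for S T using ff by metis
  moreover have "Gamma1_adj (f S) (f T) \<longleftrightarrow> Gamma1_adj S T" for S T
    unfolding Gamma1_adj_def f_def image_Int[OF inj_q, symmetric]
    by (simp add: card_image inj_on_subset[OF inj_q])
  ultimately show ?thesis unfolding coset_model_def
    by (intro exI[of _ "\<lambda>(N, r). f (coset N (stab r))"]) (simp add: coset_eq_iff Gamma1_adj_coset)
qed

lemma coset_models_iso:
  assumes e: "coset_model e V1 E1" and h: "coset_model h V2 E2"
  shows "graph_iso V1 E1 V2 E2"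
proof -
  let ?T = "(UNIV :: pauli3 set) \<times> reps"
  have V: "V1 = e ` ?T" "V2 = h ` ?T" using e h by (auto simp: coset_model_def)
  have eq: "e a = e b \<longleftrightarrow> h a = h b" and adj: "E1 (e a) (e b) \<longleftrightarrow> E2 (h a) (h b)"
    if ab: "a \<in> ?T" "b \<in> ?T" for a b
  proof -
    obtain M N r r' where "a = (M, r)" "b = (N, r')" "r \<in> reps" "r' \<in> reps" using ab by blast
    then show "e a = e b \<longleftrightarrow> h a = h b" "E1 (e a) (e b) \<longleftrightarrow> E2 (h a) (h b)"
      using e h unfolding coset_model_def by blast+
  qed
  \<comment> \<open>\<open>e\<close> identifies points of the same coset, so an arbitrary preimage
    is taken; \<open>eq\<close> makes the result independent of it.\<close>
  define f where "f = h \<circ> inv_into ?T e"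
  have f: "f (e a) = h a" if a: "a \<in> ?T" for a
  proof -
    have "inv_into ?T e (e a) \<in> ?T" "e (inv_into ?T e (e a)) = e a"
      using a by (simp_all only: inv_into_into f_inv_into_f imageI)
    then show ?thesis using eq a by (simp add: f_def)
  qed
  have "bij_betw f V1 V2"
    unfolding bij_betw_def V
  proof
    show "inj_on f (e ` ?T)"
    proof (rule inj_onI)
      fix s t assume "s \<in> e ` ?T" "t \<in> e ` ?T" and st: "f s = f t"
      then obtain a b where ab: "a \<in> ?T" "b \<in> ?T" "s = e a" "t = e b" by blast
      then have "h a = h b" using st f by metis
      then show "s = t" using ab eq by blast
    qed
    show "f ` e ` ?T = h ` ?T" unfolding image_image by (intro image_cong refl f)
  qed
  moreover have "\<forall>s\<in>V1. \<forall>t\<in>V1. E1 s t \<longleftrightarrow> E2 (f s) (f t)"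
  proof (intro ballI)
    fix s t assume "s \<in> V1" "t \<in> V1"
    then obtain a b where "a \<in> ?T" "b \<in> ?T" "s = e a" "t = e b" unfolding V by blast
    then show "E1 s t \<longleftrightarrow> E2 (f s) (f t)" using adj f by metis
  qed
  ultimately show ?thesis unfolding graph_iso_def by blast
qed

theorem theorem3p12:
  fixes w :: "vec8 set set \<Rightarrow> vec8"
    and Orb :: "nat set set set set"
  assumes "admissible_w w"
    and "Gamma1_vertex_set Orb"
  shows "graph_iso E8_verts (Gw_compl_adj w) Orb Gamma1_adj"
  using Gw_complement_model[OF assms(1)] Gamma1_model[OF assms(2)] coset_models_iso by blast

end
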